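(* For every integer $k\geq 22$, every graph $G$ on $n$ vertices of odd girth at least $2k+1$ with $\mu_2(G)>\frac{3456\,n}{k^3}$ is bipartite. Moreover, the order $k^{-3}$ is asymptotically best possible: there is an absolute constant $c>0$ such that for all sufficiently large integers $k$ there exists a non-bipartite graph $G$ of odd girth at least $2k+1$ with $\mu_2(G)\geq \frac{c\,|V(G)|}{k^3}$.
   Context: All graphs are finite and simple, with at least two vertices. For a graph $G$ on $n$ vertices, with adjacency matrix $A(G)$ and diagonal degree matrix $D(G)$, the Laplacian matrix is $L(G)=D(G)-A(G)$; its eigenvalues (with multiplicity) are listed as $0=\mu_1(G)\le\mu_2(G)\le\cdots\le\mu_n(G)$, and $\mu_2(G)$ is the algebraic connectivity of $G$. The odd girth of $G$ is the length of a shortest odd cycle of $G$ (infinite if $G$ has no odd cycle); thus odd girth at least $2k+1$ means that $G$ contains no odd cycle of length less than $2k+1$. *)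

theory Defs
  imports
    "HOL-Library.Extended_Nat"
    "HOL-Computational_Algebra.Fundamental_Theorem_Algebra"
    "Graph_Theory.Graph_Theory"
    "Jordan_Normal_Form.Char_Poly"
begin

(* A finite simple graph is a pair digraph G with pair_graph G: finite vertex set, and a
   symmetric irreflexive arc relation in which an edge uv is the pair of arcs (u,v), (v,u). *)

definition bipartite :: "'a pair_pre_digraph \<Rightarrow> bool" where
  "bipartite G \<longleftrightarrow> (\<exists>A B. A \<union> B = pverts G \<and> A \<inter> B = {} \<and>
     (\<forall>(u, v) \<in> parcs G. (u \<in> A \<and> v \<in> B) \<or> (u \<in> B \<and> v \<in> A)))"

(* The directed cycles of a simple graph are its undirected cycles with an orientation and
   the back-and-forth closed walks of length 2; the latter are even and do not matter here.
   The infimum of the empty set is infinity. *)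
definition odd_girth :: "'a pair_pre_digraph \<Rightarrow> enat" where
  "odd_girth G =
     (INF p \<in> {p. pre_digraph.cycle (with_proj G) p \<and> odd (length p)}. enat (length p))"

(* Rows and columns are indexed by an arbitrary enumeration of the vertices; another choice
   conjugates the matrices below by a permutation matrix and so leaves the spectrum unchanged. *)
definition vertex_list :: "'a pair_pre_digraph \<Rightarrow> 'a list" where
  "vertex_list G = (SOME vs. distinct vs \<and> set vs = pverts G)"

definition adjacency_matrix :: "'a pair_pre_digraph \<Rightarrow> real mat" where
  "adjacency_matrix G = (let n = card (pverts G); vs = vertex_list G in
     mat n n (\<lambda>(i, j). if (vs ! i, vs ! j) \<in> parcs G then 1 else 0))"

definition degree_matrix :: "'a pair_pre_digraph \<Rightarrow> real mat" where
  "degree_matrix G = (let n = card (pverts G); vs = vertex_list G in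
     mat n n (\<lambda>(i, j). if i = j then real (out_degree (with_proj G) (vs ! i)) else 0))"

definition laplacian :: "'a pair_pre_digraph \<Rightarrow> real mat" where
  "laplacian G = degree_matrix G - adjacency_matrix G"

(* The real roots of the characteristic polynomial with multiplicity, in increasing order;
   for a simple graph the Laplacian is symmetric, so these are all n eigenvalues. *)
definition laplacian_eigenvalues :: "'a pair_pre_digraph \<Rightarrow> real list" where
  "laplacian_eigenvalues G = sorted_list_of_multiset (proots (char_poly (laplacian G)))"

(* The second smallest eigenvalue: list positions start at 0. *)
definition algebraic_connectivity :: "'a pair_pre_digraph \<Rightarrow> real" where
  "algebraic_connectivity G = laplacian_eigenvalues G ! 1"

end

theory Submission
  imports Defs
begin

text \<open>
  Let \<open>\<mu>\<close> be the algebraic connectivity. If \<open>G\<close> is not bipartite, two vertices are at distance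
  at least \<open>k\<close>, since otherwise the parity of the distance from a vertex is a proper 2-colouring.
  The balls of radius \<open>r = (k - 1) div 2\<close> around them are disjoint, so one of them, with centre \<open>x\<close>,
  contains at most half of the vertices. Let \<open>b i\<close> be the size of the ball of radius \<open>i\<close> around \<open>x\<close>.
  A test function that is constant on the ball of radius \<open>m\<close>, vanishes from distance \<open>\<rho>\<close> on, and
  decreases in between with steps inversely proportional to the sizes of the levels gives
  \<open>\<mu> * b m * (\<rho> - m)^3 \<le> 2 * (b \<rho>)^2\<close>. With \<open>m = \<rho> div 2\<close> this propagates the bound
  \<open>b \<rho> \<le> n * \<rho>^3 / (2 * r^3)\<close> from \<open>\<rho> = r\<close> down to \<open>\<rho> = 1\<close>, where it contradicts the
  lower bound \<open>\<mu> / 2\<close> for \<open>b 1\<close>. Optimality is already witnessed by the odd cycles, whose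
  algebraic connectivity is of order \<open>n^-2\<close>.
\<close>

section \<open>Orthogonal diagonalization of real symmetric matrices\<close>

text \<open>The Householder reflection along \<open>w = v - unit_vec n 0\<close> swaps the two unit
  vectors. Being symmetric and an involution, it is its own transpose and inverse.\<close>

lemma exists_reflection_to_unit_vec:
  fixes v :: "real vec"
  assumes v: "v \<in> carrier_vec n" and unit: "v \<bullet> v = 1" and n: "n \<noteq> 0"
  shows "\<exists>W \<in> carrier_mat n n. transpose_mat W = W \<and> W * W = 1\<^sub>m n \<and> W *\<^sub>v unit_vec n 0 = v"
proof -
  define w where "w = v - unit_vec n 0"
  have w: "w \<in> carrier_vec n" using v by (auto simp: w_def)
  \<comment> \<open>For \<open>v = unit_vec n 0\<close> the vector \<open>w\<close> vanishes,
    division by zero gives \<open>t = 0\<close>, and \<open>W\<close> is the identity, as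
    desired.\<close>
  define t where "t = 2 / (w \<bullet> w)"
  define W where "W = mat n n (\<lambda>(i,j). (if i = j then 1 else 0) - t * (w $ i * w $ j))"
  have W: "W \<in> carrier_mat n n" by (simp add: W_def)
  have ww: "w \<bullet> w = (\<Sum>k<n. w $ k * w $ k)"
    using w by (simp add: scalar_prod_def atLeast0LessThan)
  have w_i: "w $ i = v $ i - (if i = 0 then 1 else 0)" if "i < n" for i
    using that v n by (auto simp: w_def unit_vec_def)
  have vv: "(\<Sum>k<n. v $ k * v $ k) = 1"
    using unit v by (simp add: scalar_prod_def atLeast0LessThan)
  \<comment> \<open>Both \<open>v\<close> and the unit vector have length 1, so
    \<open>w \<bullet> w\<close> depends only on the entry \<open>w $ 0\<close>. This makes
    \<open>t * w $ 0 = -1\<close> whenever \<open>w\<close> is nonzero.\<close>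
  have "w \<bullet> w = (\<Sum>k<n. v $ k * v $ k - (if k = 0 then 2 * v $ k - 1 else 0))"
    unfolding ww by (rule sum.cong) (auto simp: w_i algebra_simps)
  also have "\<dots> = 2 - 2 * v $ 0"
    using n by (simp add: sum_subtractf vv sum.delta)
  finally have ww0: "w \<bullet> w = - 2 * w $ 0" using n by (simp add: w_i)
  have t_sq: "t * t * (w \<bullet> w) = 2 * t" by (simp add: t_def)
  have t_w: "t * w $ 0 * w $ i = - w $ i" if "i < n" for i
  proof (cases "w \<bullet> w = 0")
    case True
    then have "w = 0\<^sub>v n" using w conjugate_square_eq_0_vec[OF w] by (simp add: conjugate_vec_def)
    then show ?thesis using that by simp
  next
    case False
    then have "t * w $ 0 = -1" unfolding t_def ww0 by (simp add: divide_simps)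
    then show ?thesis by simp
  qed
  have "W * W = 1\<^sub>m n"
  proof (rule eq_matI)
    fix i j assume ij: "i < dim_row (1\<^sub>m n :: real mat)" "j < dim_col (1\<^sub>m n :: real mat)"
    then have i: "i < n" and j: "j < n" by auto
    have "(W * W) $$ (i,j) = (\<Sum>k<n. W $$ (i,k) * W $$ (k,j))"
      using i j W by (simp add: scalar_prod_def atLeast0LessThan)
    also have "\<dots> = (\<Sum>k<n. (if k = i then (if i = j then 1 else 0) - t * (w $ i * w $ j) else 0)
        - (if k = j then t * (w $ i * w $ j) else 0)
        + t * t * (w $ i * w $ j) * (w $ k * w $ k))"
      using i j by (intro sum.cong) (auto simp: W_def algebra_simps)
    also have "\<dots> = (if i = j then 1 else 0) - 2 * t * (w $ i * w $ j) + (t * t * (w \<bullet> w)) * (w $ i * w $ j)"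
      using i j unfolding ww by (simp add: sum.distrib sum_subtractf sum_distrib_left[symmetric])
    also have "\<dots> = 1\<^sub>m n $$ (i,j)" unfolding t_sq using i j by simp
    finally show "(W * W) $$ (i,j) = 1\<^sub>m n $$ (i,j)" .
  qed (auto simp: W_def)
  moreover have "transpose_mat W = W" by (rule eq_matI) (auto simp: W_def)
  moreover have "W *\<^sub>v unit_vec n 0 = v"
  proof (rule eq_vecI)
    fix i assume "i < dim_vec v"
    then have i: "i < n" using v by auto
    then have "(W *\<^sub>v unit_vec n 0) $ i = W $$ (i,0)" using W n by simp
    then show "(W *\<^sub>v unit_vec n 0) $ i = v $ i"
      using i n t_w[OF i] w_i[OF i] by (simp add: W_def mult_ac split: if_splits)
  qed (use W v in auto)
  ultimately show ?thesis using W by blast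
qed

text \<open>Deflation by induction on the list of roots: a reflection \<open>W\<close> carries the
  first unit vector to a unit eigenvector for \<open>e\<close>, so \<open>W * A * W\<close> splits
  into the block \<open>e\<close> and a smaller symmetric block \<open>C\<close>. Cancelling the
  factor of \<open>e\<close> leaves the remaining roots for \<open>C\<close>. The diagonal keeps the
  given order of \<open>es\<close>, so a sorted list can be used later.\<close>

lemma orthogonal_diagonalization:
  fixes A :: "real mat"
  assumes A: "A \<in> carrier_mat n n" and sym: "transpose_mat A = A"
    and cp: "char_poly A = (\<Prod>e\<leftarrow>es. [:- e, 1:])"
  shows "\<exists>Q \<in> carrier_mat n n. transpose_mat Q * Q = 1\<^sub>m n \<and>
    transpose_mat Q * A * Q = mat n n (\<lambda>(i,j). if i = j then es ! i else 0)"
  using assms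
proof (induction es arbitrary: n A)
  case Nil
  then have "n = 0" using degree_monic_char_poly[of A n] by simp
  then show ?case using Nil by (intro bexI[of _ "1\<^sub>m n"]) auto
next
  case (Cons e es n A)
  have A: "A \<in> carrier_mat n n" by fact
  define m where "m = n - 1"
  have "degree (char_poly A) = length (e # es)"
    unfolding Cons.prems(3) by (rule degree_linear_factors)
  then have n: "n = Suc m" and len: "length es = m"
    using degree_monic_char_poly[OF A] by (auto simp: m_def)
  have ev: "eigenvalue A e"
    unfolding eigenvalue_root_char_poly[OF A] Cons.prems(3) by simp
  then obtain u where u: "u \<in> carrier_vec n" "u \<noteq> 0\<^sub>v n" "A *\<^sub>v u = e \<cdot>\<^sub>v u"
    using A by (auto simp: eigenvalue_def eigenvector_def)
  have uu: "u \<bullet> u > 0"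
    using u conjugate_square_greater_0_vec[OF u(1)] by (simp add: conjugate_vec_def)
  define v where "v = (1 / sqrt (u \<bullet> u)) \<cdot>\<^sub>v u"
  have v: "v \<in> carrier_vec n" using u by (simp add: v_def)
  have vv: "v \<bullet> v = 1" using u uu by (simp add: v_def)
  have Av: "A *\<^sub>v v = e \<cdot>\<^sub>v v" unfolding v_def using A u by (simp add: mult_mat_vec smult_smult_assoc mult.commute)
  obtain W where W: "W \<in> carrier_mat n n" and WT: "transpose_mat W = W"
    and WW: "W * W = 1\<^sub>m n" and W0: "W *\<^sub>v unit_vec n 0 = v"
    using exists_reflection_to_unit_vec[OF v vv] n by auto
  define B where "B = W * A * W"
  have B: "B \<in> carrier_mat n n" using A W by (simp add: B_def)
  have Bsym: "transpose_mat B = B"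
    unfolding B_def using A W Cons.prems(2) WT
    by (simp add: transpose_mult[of _ n n _ n] assoc_mult_mat[of _ n n _ n _ n])
  have "B *\<^sub>v unit_vec n 0 = W *\<^sub>v (A *\<^sub>v (W *\<^sub>v unit_vec n 0))"
    unfolding B_def using A W by (simp add: assoc_mult_mat_vec[of _ n n _ n])
  also have "\<dots> = e \<cdot>\<^sub>v (W *\<^sub>v (W *\<^sub>v unit_vec n 0))"
    unfolding W0 Av using W v by (simp add: mult_mat_vec)
  also have "\<dots> = e \<cdot>\<^sub>v ((W * W) *\<^sub>v unit_vec n 0)"
    using W by (simp add: assoc_mult_mat_vec[of _ n n _ n])
  finally have B0: "B *\<^sub>v unit_vec n 0 = e \<cdot>\<^sub>v unit_vec n 0"
    by (simp add: WW)
  \<comment> \<open>The eigenvector equation determines the first column only; symmetry of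
    \<open>B\<close> gives the first row.\<close>
  have Bcol: "B $$ (i,0) = (if i = 0 then e else 0)" if "i < n" for i
    using arg_cong[OF B0, of "\<lambda>x. x $ i"] that B n by (simp split: if_splits)
  have Brow: "B $$ (0,j) = (if j = 0 then e else 0)" if "j < n" for j
    using Bcol[OF that] arg_cong[OF Bsym, of "\<lambda>M. M $$ (0,j)"] that B n by simp
  define C where "C = mat m m (\<lambda>(i,j). B $$ (Suc i, Suc j))"
  have C: "C \<in> carrier_mat m m" by (simp add: C_def)
  have Csym: "transpose_mat C = C"
  proof (rule eq_matI)
    fix i j assume "i < dim_row C" "j < dim_col C"
    then show "transpose_mat C $$ (i,j) = C $$ (i,j)"
      using arg_cong[OF Bsym, of "\<lambda>M. M $$ (Suc i, Suc j)"] B n by (simp add: C_def)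
  qed (auto simp: C_def)
  define E where "E = mat 1 1 (\<lambda>_. e)"
  have Bblock: "B = four_block_mat E (0\<^sub>m 1 m) (0\<^sub>m m 1) C"
    by (rule eq_matI) (use B n Bcol Brow in \<open>auto simp: E_def C_def\<close>)
  have "similar_mat_wit A B W W"
    by (rule similar_mat_witI[of _ _ n])
      (use A B W WW in \<open>auto simp: B_def assoc_mult_mat[of _ n n _ n _ n]\<close>,
       metis A W WW assoc_mult_mat left_mult_one_mat right_mult_one_mat mult_carrier_mat)
  then have "char_poly A = char_poly B"
    by (intro char_poly_similar) (auto simp: similar_mat_def)
  also have "\<dots> = char_poly E * char_poly C"
    unfolding Bblock by (rule char_poly_four_block_zeros_col) (use C in \<open>auto simp: E_def\<close>)
  also have "char_poly E = [:- e, 1:]"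
    by (simp add: E_def char_poly_defs det_def sign_def)
  finally have "[:- e, 1:] * (\<Prod>e\<leftarrow>es. [:- e, 1:]) = [:- e, 1:] * char_poly C"
    unfolding Cons.prems(3) by simp
  then have "char_poly C = (\<Prod>e\<leftarrow>es. [:- e, 1:])"
    by (subst (asm) mult_cancel_left) simp
  from Cons.IH[OF C Csym this] obtain P where P: "P \<in> carrier_mat m m"
    and PP: "transpose_mat P * P = 1\<^sub>m m"
    and PCP: "transpose_mat P * C * P = mat m m (\<lambda>(i,j). if i = j then es ! i else 0)" by auto
  define R where "R = four_block_mat (1\<^sub>m 1) (0\<^sub>m 1 m) (0\<^sub>m m 1) P"
  have R: "R \<in> carrier_mat n n" using P n by (auto simp: R_def)
  have RT: "transpose_mat R = four_block_mat (1\<^sub>m 1) (0\<^sub>m 1 m) (0\<^sub>m m 1) (transpose_mat P)"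
    unfolding R_def by (subst transpose_four_block_mat[of _ 1 1 _ m _ m]) (use P in auto)
  have RR: "transpose_mat R * R = 1\<^sub>m n"
    unfolding RT unfolding R_def
    by (subst mult_four_block_mat[of _ 1 1 _ m _ m _ _ 1 _ m])
      (use P PP n four_block_one_mat[of 1 m] in auto)
  have "transpose_mat R * B = four_block_mat E (0\<^sub>m 1 m) (0\<^sub>m m 1) (transpose_mat P * C)"
    unfolding RT Bblock
    by (subst mult_four_block_mat[of _ 1 1 _ m _ m _ _ 1 _ m]) (use P C in \<open>auto simp: E_def\<close>)
  then have RBR: "transpose_mat R * B * R = four_block_mat E (0\<^sub>m 1 m) (0\<^sub>m m 1) (transpose_mat P * C * P)"
    unfolding R_def
    by (simp only:, subst mult_four_block_mat[of _ 1 1 _ m _ m _ _ 1 _ m]) (use P C in \<open>auto simp: E_def\<close>)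
  define Q where "Q = W * R"
  have Q: "Q \<in> carrier_mat n n" using W R by (simp add: Q_def)
  have QT: "transpose_mat Q = transpose_mat R * W"
    unfolding Q_def using W R WT by (simp add: transpose_mult[of _ n n _ n])
  have "transpose_mat Q * Q = transpose_mat R * ((W * W) * R)"
    unfolding QT unfolding Q_def using W R by (simp add: assoc_mult_mat[of _ n n _ n _ n])
  then have QQ: "transpose_mat Q * Q = 1\<^sub>m n" using R RR WW by simp
  have "transpose_mat Q * A * Q = transpose_mat R * B * R"
    unfolding QT unfolding Q_def B_def using W R A by (simp add: assoc_mult_mat[of _ n n _ n _ n])
  also have "\<dots> = mat n n (\<lambda>(i,j). if i = j then (e # es) ! i else 0)"
    unfolding RBR PCP by (rule eq_matI) (auto simp: E_def n nth_Cons')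
  finally show ?case using Q QQ by blast
qed

text \<open>The polynomial factors over the complex numbers. A root \<open>a\<close> with
  eigenvector \<open>v\<close> satisfies \<open>a = cnj a\<close>, by moving \<open>C\<close> across
  the product \<open>v \<bullet> conjugate v\<close>. The factorization into real linear factors
  then descends by injectivity of the embedding.\<close>

lemma char_poly_symmetric_splits:
  fixes A :: "real mat"
  assumes A: "A \<in> carrier_mat n n" and sym: "transpose_mat A = A"
  shows "\<exists>es. char_poly A = (\<Prod>e\<leftarrow>es. [:- e, 1:])"
proof -
  interpret p: map_poly_inj_idom_hom complex_of_real ..
  define C where "C = map_mat complex_of_real A"
  have C: "C \<in> carrier_mat n n" using A by (simp add: C_def)
  have CT: "transpose_mat C = C" 
    using arg_cong[OF sym, of "map_mat complex_of_real"] by (simp add: C_def map_mat_transpose)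
  obtain as where as: "char_poly C = (\<Prod>a\<leftarrow>as. [:- a, 1:])"
    using char_poly_factorized[OF C] by auto
  have real: "complex_of_real (Re a) = a" if a: "a \<in> set as" for a
  proof -
    have "poly (char_poly C) a = 0"
      unfolding as poly_prod_list using a by (auto simp: prod_list_zero_iff)
    then have "eigenvalue C a" unfolding eigenvalue_root_char_poly[OF C] .
    then obtain v where v: "v \<in> carrier_vec n" "v \<noteq> 0\<^sub>v n" "C *\<^sub>v v = a \<cdot>\<^sub>v v"
      using C by (auto simp: eigenvalue_def eigenvector_def)
    have conj: "C *\<^sub>v conjugate v = cnj a \<cdot>\<^sub>v conjugate v"
    proof (rule eq_vecI)
      fix i assume "i < dim_vec (cnj a \<cdot>\<^sub>v conjugate v)"
      then have i: "i < n" using v by simp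
      have "(C *\<^sub>v conjugate v) $ i = cnj ((C *\<^sub>v v) $ i)"
        using i A v(1) by (simp add: C_def scalar_prod_def)
      then show "(C *\<^sub>v conjugate v) $ i = (cnj a \<cdot>\<^sub>v conjugate v) $ i"
        unfolding v(3) using i v(1) by simp
    qed (use C v in auto)
    have "a * (v \<bullet> conjugate v) = (C *\<^sub>v v) \<bullet> conjugate v"
      using v by simp
    also have "\<dots> = v \<bullet> (C *\<^sub>v conjugate v)"
      using transpose_vec_mult_scalar[OF C, of "conjugate v" v] v CT 
       by (simp add: comm_scalar_prod[of _ n])
    also have "\<dots> = cnj a * (v \<bullet> conjugate v)" unfolding conj using v by simp
    finally have "a = cnj a" using v conjugate_square_eq_0_vec[OF v(1)] by simp
    then show ?thesis by (metis Reals_cnj_iff of_real_Re)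
  qed
  have "map_poly complex_of_real (char_poly A) = char_poly C"
    unfolding C_def by (rule of_real_hom.char_poly_hom[OF A, symmetric])
  also have "\<dots> = (\<Prod>a\<leftarrow>as. [:- complex_of_real (Re a), 1:])"
    unfolding as using real by (intro arg_cong[where f = prod_list] map_cong) auto
  also have "\<dots> = map_poly complex_of_real (\<Prod>e\<leftarrow>map Re as. [:- e, 1:])"
    by (induction as) (simp_all add: p.hom_mult of_real_hom.map_poly_pCons_hom del: mult_pCons_left)
  finally have "char_poly A = (\<Prod>e\<leftarrow>map Re as. [:- e, 1:])"
    by (simp only: p.eq_iff)
  then show ?thesis by blast
qed

section \<open>Variational characterization of the second eigenvalue\<close>

abbreviation spectrum_list :: "real mat \<Rightarrow> real list" where
  "spectrum_list A \<equiv> sorted_list_of_multiset (proots (char_poly A))"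

text \<open>As the characteristic polynomial splits over the reals, the sorted multiset of its real
  roots misses no eigenvalue.\<close>

lemma symmetric_spectrum_list:
  fixes A :: "real mat"
  assumes A: "A \<in> carrier_mat n n" and sym: "transpose_mat A = A"
  shows "char_poly A = (\<Prod>e\<leftarrow>spectrum_list A. [:- e, 1:])" "length (spectrum_list A) = n"
proof -
  obtain es where es: "char_poly A = (\<Prod>e\<leftarrow>es. [:- e, 1:])"
    using char_poly_symmetric_splits[OF A sym] by blast
  have "proots (\<Prod>e\<leftarrow>es. [:- e, 1:]) = mset es"
  proof (induction es)
    case (Cons e es)
    have "(\<Prod>e\<leftarrow>es. [:- e, 1:]) \<noteq> 0" by (auto simp: prod_list_zero_iff)
    then have "proots ([:- e, 1:] * (\<Prod>e\<leftarrow>es. [:- e, 1:])) = {#e#} + proots (\<Prod>e\<leftarrow>es. [:- e, 1:])"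
      by (subst proots_mult) auto
    then show ?case using Cons.IH by (simp del: mult_pCons_left)
  qed simp
  then have "mset (spectrum_list A) = mset es" by (simp add: es)
  then have "mset (map (\<lambda>e. [:- e, 1:]) (spectrum_list A)) = mset (map (\<lambda>e. [:- e, 1:]) es)"
    by (metis mset_map)
  then show *: "char_poly A = (\<Prod>e\<leftarrow>spectrum_list A. [:- e, 1:])"
    unfolding es by (metis prod_mset_prod_list)
  show "length (spectrum_list A) = n"
    using degree_monic_char_poly[OF A] degree_linear_factors[of uminus "spectrum_list A"]
    unfolding *[symmetric] by simp
qed

text \<open>The columns of the diagonalizing matrix serve as \<open>q\<close>; the last two
  properties are Parseval's identity and the quadratic form in eigencoordinates, indexed in
  increasing order of eigenvalues.\<close>

lemma symmetric_eigenbasis: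
  fixes A :: "real mat"
  assumes A: "A \<in> carrier_mat n n" and sym: "transpose_mat A = A"
  obtains q :: "nat \<Rightarrow> real vec"
  where "\<And>i. i < n \<Longrightarrow> q i \<in> carrier_vec n"
    and "\<And>i j. i < n \<Longrightarrow> j < n \<Longrightarrow> q i \<bullet> q j = (if i = j then 1 else 0)"
    and "\<And>x. x \<in> carrier_vec n \<Longrightarrow> x \<bullet> x = (\<Sum>i<n. (q i \<bullet> x)\<^sup>2)"
    and "\<And>x. x \<in> carrier_vec n \<Longrightarrow> x \<bullet> (A *\<^sub>v x) = (\<Sum>i<n. spectrum_list A ! i * (q i \<bullet> x)\<^sup>2)"
proof -
  define D where "D = mat n n (\<lambda>(i,j). if i = j then spectrum_list A ! i else 0)"
  have D: "D \<in> carrier_mat n n" by (simp add: D_def)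
  obtain Q where Q: "Q \<in> carrier_mat n n" and QQ: "transpose_mat Q * Q = 1\<^sub>m n"
    and QAQ: "transpose_mat Q * A * Q = D"
    using orthogonal_diagonalization[OF A sym symmetric_spectrum_list(1)[OF A sym]] unfolding D_def by blast
  have QT: "transpose_mat Q \<in> carrier_mat n n" using Q by simp
  have QQ': "Q * transpose_mat Q = 1\<^sub>m n" by (rule mat_mult_left_right_inverse[OF QT Q QQ])
  have AQ: "A = Q * D * transpose_mat Q"
  proof -
    have "Q * D * transpose_mat Q = (Q * transpose_mat Q) * A * (Q * transpose_mat Q)"
      unfolding QAQ[symmetric] using A Q by (simp add: assoc_mult_mat[of _ n n _ n _ n])
    then show ?thesis using A QQ' by simp
  qed
  have coord: "(transpose_mat Q *\<^sub>v x) $ i = col Q i \<bullet> x" if "i < n" for i x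
    using that Q by simp
  have adj: "x \<bullet> (Q *\<^sub>v y) = (transpose_mat Q *\<^sub>v x) \<bullet> y" 
    if "x \<in> carrier_vec n" "y \<in> carrier_vec n" for x y
    using transpose_vec_mult_scalar[OF Q that(2,1)] by (rule HOL.sym)
  show ?thesis
  proof (rule that[of "col Q"])
    fix i j assume "i < n" "j < n"
    then show "col Q i \<bullet> col Q j = (if i = j then 1 else 0)"
      using arg_cong[OF QQ, of "\<lambda>M. M $$ (i,j)"] Q by simp
  next
    fix x :: "real vec" assume x: "x \<in> carrier_vec n"
    define y where "y = transpose_mat Q *\<^sub>v x"
    have y: "y \<in> carrier_vec n" using QT x by (simp add: y_def)
    have "x = Q *\<^sub>v y" unfolding y_def using Q x QQ' by (simp flip: assoc_mult_mat_vec)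
    then have "x \<bullet> x = y \<bullet> y" using adj[OF x y] by (simp add: y_def)
    then show "x \<bullet> x = (\<Sum>i<n. (col Q i \<bullet> x)\<^sup>2)"
      using y coord[of _ x] by (simp add: scalar_prod_def atLeast0LessThan power2_eq_square flip: y_def)
    have "A *\<^sub>v x = Q *\<^sub>v (D *\<^sub>v y)"
      by (subst AQ) (use Q D x y_def in \<open>simp add: assoc_mult_mat_vec[of _ n n _ n]\<close>)
    then have "x \<bullet> (A *\<^sub>v x) = y \<bullet> (D *\<^sub>v y)"
      using adj[OF x, of "D *\<^sub>v y"] D y by (simp add: y_def)
    also have "\<dots> = (\<Sum>i<n. y $ i * (\<Sum>j<n. if j = i then spectrum_list A ! i * y $ i else 0))"
      unfolding scalar_prod_def atLeast0LessThan using y D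
      by (auto simp: scalar_prod_def atLeast0LessThan D_def if_distrib[of "\<lambda>t. t * _"]
          cong: if_cong intro!: sum.cong arg_cong2[where f = "(*)"])
    also have "\<dots> = (\<Sum>i<n. spectrum_list A ! i * (col Q i \<bullet> x)\<^sup>2)"
      using coord[of _ x] by (intro sum.cong) (auto simp: power2_eq_square simp flip: y_def)
    finally show "x \<bullet> (A *\<^sub>v x) = (\<Sum>i<n. spectrum_list A ! i * (col Q i \<bullet> x)\<^sup>2)" .
  qed (use Q in auto)
qed

lemma spectrum_list_mono:
  assumes "A \<in> carrier_mat n n" "transpose_mat A = A" "i \<le> j" "j < n"
  shows "spectrum_list A ! i \<le> spectrum_list A ! j"
  using symmetric_spectrum_list(2)[OF assms(1,2)] assms(3,4)
  by (intro sorted_nth_mono) auto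

text \<open>The kernel vector \<open>z\<close> may differ from the first basis vector
  \<open>q 0\<close>, so the bound is first shown orthogonally to \<open>q 0\<close> and then
  applied to a combination \<open>y\<close> of \<open>z\<close> and \<open>x\<close> lying there.
  Adding a multiple of \<open>z\<close> leaves the quadratic form unchanged and, since
  \<open>z\<close> is orthogonal to \<open>x\<close>, can only increase the norm.\<close>

lemma second_eigenvalue_le_Rayleigh:
  fixes A :: "real mat"
  assumes A: "A \<in> carrier_mat n n" and sym: "transpose_mat A = A" and n: "2 \<le> n"
    and psd: "\<And>y. y \<in> carrier_vec n \<Longrightarrow> 0 \<le> y \<bullet> (A *\<^sub>v y)"
    and z: "z \<in> carrier_vec n" "z \<noteq> 0\<^sub>v n" "A *\<^sub>v z = 0\<^sub>v n"
    and x: "x \<in> carrier_vec n" "z \<bullet> x = 0"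
  shows "spectrum_list A ! 1 * (x \<bullet> x) \<le> x \<bullet> (A *\<^sub>v x)"
proof (cases "spectrum_list A ! 1 \<le> 0")
  case True
  have "0 \<le> x \<bullet> x" by (simp add: scalar_prod_def sum_nonneg)
  with True psd[OF x(1)] show ?thesis
    by (meson mult_nonpos_nonneg order_trans)
next
  case False
  let ?\<mu> = "spectrum_list A ! 1"
  obtain q where q: "\<And>i. i < n \<Longrightarrow> q i \<in> carrier_vec n"
    "\<And>i j. i < n \<Longrightarrow> j < n \<Longrightarrow> q i \<bullet> q j = (if i = j then 1 else 0)"
    "\<And>x. x \<in> carrier_vec n \<Longrightarrow> x \<bullet> x = (\<Sum>i<n. (q i \<bullet> x)\<^sup>2)"
    "\<And>x. x \<in> carrier_vec n \<Longrightarrow> x \<bullet> (A *\<^sub>v x) = (\<Sum>i<n. spectrum_list A ! i * (q i \<bullet> x)\<^sup>2)"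
    by (rule symmetric_eigenbasis[OF A sym]) blast
  have orth: "?\<mu> * (y \<bullet> y) \<le> y \<bullet> (A *\<^sub>v y)" if y: "y \<in> carrier_vec n" "q 0 \<bullet> y = 0" for y
    unfolding q(3,4)[OF y(1)] sum_distrib_left
  proof (rule sum_mono)
    fix i assume i: "i \<in> {..<n}"
    show "?\<mu> * (q i \<bullet> y)\<^sup>2 \<le> spectrum_list A ! i * (q i \<bullet> y)\<^sup>2"
    proof (cases "i = 0")
      case False
      then show ?thesis using i spectrum_list_mono[OF A sym, of 1 i] by (intro mult_right_mono) auto
    qed (simp add: y)
  qed
  have q0: "q 0 \<in> carrier_vec n" using q(1) n by simp
  \<comment> \<open>These coefficients make the contributions of \<open>z\<close> and
    \<open>x\<close> to \<open>q 0 \<bullet> y\<close> cancel.\<close>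
  define a b where "a = q 0 \<bullet> x" and "b = - (q 0 \<bullet> z)"
  show ?thesis
  proof (cases "a = 0")
    case True
    then show ?thesis using orth[OF x(1)] by (simp add: a_def)
  next
    case a: False
    define y where "y = a \<cdot>\<^sub>v z + b \<cdot>\<^sub>v x"
    have y: "y \<in> carrier_vec n" using x z by (simp add: y_def)
    have "q 0 \<bullet> y = 0" unfolding y_def using q0 x z
      by (simp add: scalar_prod_add_distrib[of _ n] a_def b_def)
    then have R: "?\<mu> * (y \<bullet> y) \<le> y \<bullet> (A *\<^sub>v y)" by (rule orth[OF y])
    have xz: "x \<bullet> z = 0" using x z by (simp add: comm_scalar_prod[of _ n])
    have yy: "y \<bullet> y = a\<^sup>2 * (z \<bullet> z) + b\<^sup>2 * (x \<bullet> x)"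
      unfolding y_def using x z xz
      by (simp add: scalar_prod_add_distrib[of _ n] add_scalar_prod_distrib[of _ n] power2_eq_square)
    have "a \<cdot>\<^sub>v 0\<^sub>v n = 0\<^sub>v n" by (rule eq_vecI) auto
    then have Ay: "A *\<^sub>v y = b \<cdot>\<^sub>v (A *\<^sub>v x)"
      unfolding y_def using A x z
      by (simp add: mult_add_distrib_mat_vec[of _ n n] mult_mat_vec[of _ n n])
    have "z \<bullet> (A *\<^sub>v x) = (A *\<^sub>v z) \<bullet> x"
      using transpose_vec_mult_scalar[OF A x(1) z(1)] sym by simp
    then have zA: "z \<bullet> (A *\<^sub>v x) = 0" using z x by simp
    have yAy: "y \<bullet> (A *\<^sub>v y) = b\<^sup>2 * (x \<bullet> (A *\<^sub>v x))"
      unfolding Ay unfolding y_def using A x z zA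
      by (simp add: add_scalar_prod_distrib[of _ n] power2_eq_square)
    have zz: "0 \<le> z \<bullet> z" by (simp add: scalar_prod_def sum_nonneg)
    show ?thesis
    proof (cases "b = 0")
      \<comment> \<open>Here \<open>z\<close> itself is orthogonal to \<open>q 0\<close>, where the
        form is positive definite because the second eigenvalue is positive; a nonzero kernel vector
        is impossible.\<close>
      case True
      then have "?\<mu> * (a\<^sup>2 * (z \<bullet> z)) \<le> 0" using R yy yAy by simp
      then have "z \<bullet> z = 0" using False a zz by (simp add: mult_le_0_iff)
      then have "z = 0\<^sub>v n" using conjugate_square_eq_0_vec[OF z(1)] by (simp add: conjugate_vec_def)
      then show ?thesis using z by simp
    next
      case b: False
      have "0 \<le> ?\<mu> * (a\<^sup>2 * (z \<bullet> z))" using False zz by simp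
      then have "b\<^sup>2 * (?\<mu> * (x \<bullet> x)) \<le> b\<^sup>2 * (x \<bullet> (A *\<^sub>v x))" 
        using R unfolding yy yAy by (simp add: algebra_simps)
      then show ?thesis using b by simp
    qed
  qed
qed

text \<open>The max-min principle: the plane spanned by \<open>q 0\<close> and \<open>q 1\<close>
  contains a nonzero vector orthogonal to \<open>z\<close>, and on this plane the Rayleigh quotient
  is at most the second eigenvalue.\<close>

lemma second_eigenvalue_ge:
  fixes A :: "real mat"
  assumes A: "A \<in> carrier_mat n n" and sym: "transpose_mat A = A" and n: "2 \<le> n"
    and z: "z \<in> carrier_vec n"
    and R: "\<And>x. x \<in> carrier_vec n \<Longrightarrow> z \<bullet> x = 0 \<Longrightarrow> c * (x \<bullet> x) \<le> x \<bullet> (A *\<^sub>v x)"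
  shows "c \<le> spectrum_list A ! 1"
proof -
  let ?\<mu> = "spectrum_list A ! 1"
  obtain q where q: "\<And>i. i < n \<Longrightarrow> q i \<in> carrier_vec n"
    "\<And>i j. i < n \<Longrightarrow> j < n \<Longrightarrow> q i \<bullet> q j = (if i = j then 1 else 0)"
    "\<And>x. x \<in> carrier_vec n \<Longrightarrow> x \<bullet> x = (\<Sum>i<n. (q i \<bullet> x)\<^sup>2)"
    "\<And>x. x \<in> carrier_vec n \<Longrightarrow> x \<bullet> (A *\<^sub>v x) = (\<Sum>i<n. spectrum_list A ! i * (q i \<bullet> x)\<^sup>2)"
    by (rule symmetric_eigenbasis[OF A sym]) blast
  have "\<exists>a b. a * (z \<bullet> q 0) + b * (z \<bullet> q 1) = 0 \<and> (a \<noteq> 0 \<or> b \<noteq> 0)"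
  proof (cases "z \<bullet> q 0 = 0")
    case True
    then show ?thesis by (intro exI[of _ 1] exI[of _ 0]) simp
  next
    case False
    then show ?thesis
      by (intro exI[of _ "z \<bullet> q 1"] exI[of _ "- (z \<bullet> q 0)"]) (simp add: mult.commute)
  qed
  then obtain a b where ab: "a * (z \<bullet> q 0) + b * (z \<bullet> q 1) = 0" "a \<noteq> 0 \<or> b \<noteq> 0" by blast
  have q01: "q 0 \<in> carrier_vec n" "q 1 \<in> carrier_vec n" using q(1) n by auto
  define x where "x = a \<cdot>\<^sub>v q 0 + b \<cdot>\<^sub>v q 1"
  have x: "x \<in> carrier_vec n" using q01 by (simp add: x_def)
  have "z \<bullet> x = 0" unfolding x_def using q01 z ab(1) by (simp add: scalar_prod_add_distrib[of _ n])
  then have "c * (x \<bullet> x) \<le> x \<bullet> (A *\<^sub>v x)" by (rule R[OF x])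
  also have "\<dots> \<le> ?\<mu> * (x \<bullet> x)"
    unfolding q(3,4)[OF x] sum_distrib_left
  proof (rule sum_mono)
    fix i assume i: "i \<in> {..<n}"
    then have "q i \<bullet> x = (if i = 0 then a else if i = 1 then b else 0)"
      unfolding x_def using q01 q(1)[of i] q(2)[of i 0] q(2)[of i 1] n by (simp add: scalar_prod_add_distrib[of _ n])
    then show "spectrum_list A ! i * (q i \<bullet> x)\<^sup>2 \<le> ?\<mu> * (q i \<bullet> x)\<^sup>2"
      using spectrum_list_mono[OF A sym, of 0 1] n by (auto intro!: mult_right_mono)
  qed
  finally have "c * (x \<bullet> x) \<le> ?\<mu> * (x \<bullet> x)" .
  moreover have "x \<bullet> x = a\<^sup>2 + b\<^sup>2"
    unfolding x_def using q01 q(2)[of 0 0] q(2)[of 0 1] q(2)[of 1 0] q(2)[of 1 1] n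
    by (simp add: scalar_prod_add_distrib[of _ n] add_scalar_prod_distrib[of _ n] power2_eq_square)
  moreover have "a\<^sup>2 + b\<^sup>2 > 0" using ab(2) by (simp add: sum_power2_gt_zero_iff)
  ultimately show ?thesis by simp
qed

section \<open>Rayleigh quotients of the Laplacian\<close>

text \<open>Every edge contributes two arcs, hence the factor 1/2. This is the quadratic form of the
  Laplacian.\<close>

definition dirichlet_energy :: "'a pair_pre_digraph \<Rightarrow> ('a \<Rightarrow> real) \<Rightarrow> real" where
  "dirichlet_energy G f = (\<Sum>(u, v)\<in>parcs G. (f u - f v)\<^sup>2) / 2"

context pair_graph
begin

lemma vertex_list: "distinct (vertex_list G)" "set (vertex_list G) = pverts G"
  using someI_ex[OF finite_distinct_list[OF pair_finite_verts]] 
  unfolding vertex_list_def by (auto simp: conj_commute)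

lemma length_vertex_list: "length (vertex_list G) = card (pverts G)"
  using distinct_card[OF vertex_list(1)] vertex_list(2) by simp

lemma sum_vertex_list:
  "(\<Sum>i<card (pverts G). h (vertex_list G ! i)) = (\<Sum>u\<in>pverts G. h u)"
  using bij_betw_nth[OF vertex_list(1) refl refl] 
  by (intro sum.reindex_bij_betw) (simp add: length_vertex_list vertex_list(2))

lemma sum_parcs_eq:
  fixes h :: "'a \<Rightarrow> 'a \<Rightarrow> real"
  shows "(\<Sum>(u, v)\<in>parcs G. h u v) = (\<Sum>u\<in>pverts G. \<Sum>v\<in>pverts G. if (u, v) \<in> parcs G then h u v else 0)"
proof -
  have "parcs G \<subseteq> pverts G \<times> pverts G" using wellformed' by auto
  then have "(\<Sum>(u, v)\<in>parcs G. h u v) = (\<Sum>(u, v)\<in>pverts G \<times> pverts G. if (u, v) \<in> parcs G then h u v else 0)"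
    by (intro sum.mono_neutral_cong_left) (auto simp: pair_finite_verts)
  then show ?thesis by (simp add: sum.cartesian_product)
qed

lemma parcs_commute: "(u, v) \<in> parcs G \<longleftrightarrow> (v, u) \<in> parcs G"
  using arcs_symmetric by blast

lemma out_degree_eq_sum:
  "real (out_degree (with_proj G) u) = (\<Sum>v\<in>pverts G. if (u, v) \<in> parcs G then 1 else 0)"
proof -
  have "out_arcs (with_proj G) u = Pair u ` {v \<in> pverts G. (u, v) \<in> parcs G}"
    using wellformed' by (auto simp: out_arcs_def)
  then show ?thesis
    by (simp add: out_degree_def card_image inj_on_def pair_finite_verts flip: sum.inter_filter)
qed

lemma laplacian_carrier: "laplacian G \<in> carrier_mat (card (pverts G)) (card (pverts G))"
  by (auto simp: laplacian_def degree_matrix_def adjacency_matrix_def Let_def)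

lemma laplacian_symmetric: "transpose_mat (laplacian G) = laplacian G"
  by (rule eq_matI)
    (auto simp: laplacian_def degree_matrix_def adjacency_matrix_def Let_def parcs_commute)

text \<open>Passing between functions on vertices and coordinate vectors confines the arbitrary
  enumeration to this section.\<close>

definition vertex_vec :: "('a \<Rightarrow> real) \<Rightarrow> real vec" where
  "vertex_vec f = vec (card (pverts G)) (\<lambda>i. f (vertex_list G ! i))"

lemma vertex_vec_carrier: "vertex_vec f \<in> carrier_vec (card (pverts G))"
  by (simp add: vertex_vec_def)

lemma scalar_prod_vertex_vec: "vertex_vec f \<bullet> vertex_vec g = (\<Sum>u\<in>pverts G. f u * g u)"
  unfolding vertex_vec_def scalar_prod_def
  using sum_vertex_list[of "\<lambda>u. f u * g u"] by (simp add: atLeast0LessThan)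

lemma vertex_vec_surj:
  assumes "x \<in> carrier_vec (card (pverts G))"
  obtains f where "x = vertex_vec f"
proof -
  have bij: "bij_betw ((!) (vertex_list G)) {..<card (pverts G)} (pverts G)"
    using bij_betw_nth[OF vertex_list(1) refl refl] by (simp add: length_vertex_list vertex_list(2))
  define f where "f u = x $ inv_into {..<card (pverts G)} ((!) (vertex_list G)) u" for u
  have "x = vertex_vec f"
    using assms bij_betw_inv_into_left[OF bij] by (intro eq_vecI) (auto simp: vertex_vec_def f_def)
  then show ?thesis by (rule that)
qed

lemma laplacian_mult_vertex_vec:
  "laplacian G *\<^sub>v vertex_vec f =
    vertex_vec (\<lambda>u. \<Sum>v\<in>pverts G. if (u, v) \<in> parcs G then f u - f v else 0)" (is "_ = vertex_vec ?h")
proof (rule eq_vecI)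
  fix i assume "i < dim_vec (vertex_vec ?h)"
  then have i: "i < card (pverts G)" by (simp add: vertex_vec_def)
  let ?u = "vertex_list G ! i"
  have "(laplacian G *\<^sub>v vertex_vec f) $ i
      = (\<Sum>j<card (pverts G). ((if j = i then real (out_degree (with_proj G) ?u) else 0)
          - (if (?u, vertex_list G ! j) \<in> parcs G then 1 else 0)) * f (vertex_list G ! j))"
    using i by (simp add: laplacian_def degree_matrix_def adjacency_matrix_def Let_def vertex_vec_def
      scalar_prod_def atLeast0LessThan eq_commute cong: if_cong)
  also have "\<dots> = real (out_degree (with_proj G) ?u) * f ?u
      - (\<Sum>j<card (pverts G). if (?u, vertex_list G ! j) \<in> parcs G then f (vertex_list G ! j) else 0)"
    using i by (simp add: left_diff_distrib sum_subtractf if_distrib[of "\<lambda>t. t * _"] cong: if_cong)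
  also have "\<dots> = ?h ?u"
    unfolding sum_vertex_list[of "\<lambda>v. if (?u, v) \<in> parcs G then f v else 0"] out_degree_eq_sum
      sum_distrib_right sum_subtractf[symmetric] by (intro sum.cong) auto
  finally show "(laplacian G *\<^sub>v vertex_vec f) $ i = vertex_vec ?h $ i"
    using i by (simp add: vertex_vec_def)
qed (use laplacian_carrier in \<open>auto simp: vertex_vec_def\<close>)

text \<open>Exchanging the endpoints of the arcs gives a second expression for the form
  \<open>S\<close>; adding the two completes the squares.\<close>

lemma laplacian_quadratic_form:
  "vertex_vec f \<bullet> (laplacian G *\<^sub>v vertex_vec f) = dirichlet_energy G f"
proof -
  let ?V = "pverts G"
  define S where "S = (\<Sum>u\<in>?V. \<Sum>v\<in>?V. if (u, v) \<in> parcs G then f u * (f u - f v) else 0)"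
  have "vertex_vec f \<bullet> (laplacian G *\<^sub>v vertex_vec f) = S"
    unfolding laplacian_mult_vertex_vec scalar_prod_vertex_vec sum_distrib_left S_def
    by (intro sum.cong) auto
  moreover have "S = (\<Sum>u\<in>?V. \<Sum>v\<in>?V. if (u, v) \<in> parcs G then f v * (f v - f u) else 0)"
    unfolding S_def by (subst sum.swap) (simp add: parcs_commute)
  then have "S + S = (\<Sum>u\<in>?V. \<Sum>v\<in>?V. if (u, v) \<in> parcs G then (f u - f v)\<^sup>2 else 0)"
    by (subst (1) S_def, simp add: sum.distrib[symmetric]) 
      (intro sum.cong refl, auto simp: algebra_simps power2_eq_square)
  then have "S + S = (\<Sum>(u, v)\<in>parcs G. (f u - f v)\<^sup>2)" by (simp only: sum_parcs_eq)
  ultimately show ?thesis unfolding dirichlet_energy_def by simp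
qed

lemma algebraic_connectivity_le_Rayleigh:
  assumes n: "2 \<le> card (pverts G)" and f: "(\<Sum>u\<in>pverts G. f u) = 0"
  shows "algebraic_connectivity G * (\<Sum>u\<in>pverts G. (f u)\<^sup>2) \<le> dirichlet_energy G f"
proof -
  have "spectrum_list (laplacian G) ! 1 * (vertex_vec f \<bullet> vertex_vec f)
      \<le> vertex_vec f \<bullet> (laplacian G *\<^sub>v vertex_vec f)"
  proof (rule second_eigenvalue_le_Rayleigh[OF laplacian_carrier laplacian_symmetric n _
        vertex_vec_carrier _ _ vertex_vec_carrier])
    show "vertex_vec (\<lambda>_. 1) \<noteq> 0\<^sub>v (card (pverts G))"
    proof
      assume "vertex_vec (\<lambda>_. 1) = 0\<^sub>v (card (pverts G))"
      then have "vertex_vec (\<lambda>_. 1) $ 0 = 0" using n by simp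
      then show False using n by (simp add: vertex_vec_def)
    qed
    show "laplacian G *\<^sub>v vertex_vec (\<lambda>_. 1) = 0\<^sub>v (card (pverts G))"
      unfolding laplacian_mult_vertex_vec by (rule eq_vecI) (auto simp: vertex_vec_def cong: if_cong)
    show "vertex_vec (\<lambda>_. 1) \<bullet> vertex_vec f = 0" using f by (simp add: scalar_prod_vertex_vec)
  next
    fix y :: "real vec" assume "y \<in> carrier_vec (card (pverts G))"
    then obtain g where "y = vertex_vec g" by (rule vertex_vec_surj)
    then show "0 \<le> y \<bullet> (laplacian G *\<^sub>v y)"
      by (auto simp: laplacian_quadratic_form dirichlet_energy_def intro!: sum_nonneg)
  qed
  then show ?thesis
    by (simp add: laplacian_quadratic_form scalar_prod_vertex_vec power2_eq_square
      algebraic_connectivity_def laplacian_eigenvalues_def)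
qed

lemma algebraic_connectivity_geI:
  assumes n: "2 \<le> card (pverts G)"
    and R: "\<And>f. (\<Sum>u\<in>pverts G. f u) = 0 \<Longrightarrow> c * (\<Sum>u\<in>pverts G. (f u)\<^sup>2) \<le> dirichlet_energy G f"
  shows "c \<le> algebraic_connectivity G"
  unfolding algebraic_connectivity_def laplacian_eigenvalues_def
proof (rule second_eigenvalue_ge[OF laplacian_carrier laplacian_symmetric n vertex_vec_carrier])
  fix x :: "real vec" assume "x \<in> carrier_vec (card (pverts G))" and 0: "vertex_vec (\<lambda>_. 1) \<bullet> x = 0"
  then obtain f where f: "x = vertex_vec f" by (auto elim: vertex_vec_surj)
  have "(\<Sum>u\<in>pverts G. f u) = 0" using 0 by (simp add: f scalar_prod_vertex_vec)
  from R[OF this] show "c * (x \<bullet> x) \<le> x \<bullet> (laplacian G *\<^sub>v x)"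
    by (simp add: f laplacian_quadratic_form scalar_prod_vertex_vec power2_eq_square)
qed

end

section \<open>Growth of balls\<close>

text \<open>Lagrange's identity: twice the difference of the two sides is a double sum of
  squares.\<close>

lemma Cauchy_Schwarz_sum:
  fixes a b :: "'i \<Rightarrow> real"
  shows "(\<Sum>i\<in>I. a i * b i)\<^sup>2 \<le> (\<Sum>i\<in>I. (a i)\<^sup>2) * (\<Sum>i\<in>I. (b i)\<^sup>2)"
proof -
  have "0 \<le> (\<Sum>i\<in>I. \<Sum>j\<in>I. (a i * b j - a j * b i)\<^sup>2)" by (intro sum_nonneg) simp
  also have "\<dots> = (\<Sum>i\<in>I. \<Sum>j\<in>I. (a i)\<^sup>2 * (b j)\<^sup>2) + (\<Sum>i\<in>I. \<Sum>j\<in>I. (a j)\<^sup>2 * (b i)\<^sup>2)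
      - 2 * (\<Sum>i\<in>I. \<Sum>j\<in>I. (a i * b i) * (a j * b j))"
    unfolding sum.distrib[symmetric] sum_subtractf[symmetric] sum_distrib_left
    by (intro sum.cong refl) (simp add: power2_eq_square algebra_simps)
  also have "(\<Sum>i\<in>I. \<Sum>j\<in>I. (a j)\<^sup>2 * (b i)\<^sup>2) = (\<Sum>i\<in>I. \<Sum>j\<in>I. (a i)\<^sup>2 * (b j)\<^sup>2)"
    by (rule sum.swap)
  finally show ?thesis
    unfolding sum_product[symmetric] power2_eq_square[of "sum _ _"] by linarith
qed

context pair_graph
begin

lemma dirichlet_energy_shift: "dirichlet_energy G (\<lambda>u. f u - c) = dirichlet_energy G f"
  by (simp add: dirichlet_energy_def)

text \<open>Subtracting the mean makes \<open>f\<close> admissible in the Rayleigh quotient. By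
  Cauchy-Schwarz on a support of at most half of the vertices, this loses at most half of the
  squared norm, which accounts for the factor 2.\<close>

lemma algebraic_connectivity_le_small_support:
  assumes n: "2 \<le> card (pverts G)" and pos: "0 \<le> algebraic_connectivity G"
    and S: "S \<subseteq> pverts G" "2 * card S \<le> card (pverts G)" "\<And>u. u \<in> pverts G - S \<Longrightarrow> f u = 0"
  shows "algebraic_connectivity G * (\<Sum>u\<in>pverts G. (f u)\<^sup>2) \<le> 2 * dirichlet_energy G f"
proof -
  let ?V = "pverts G"
  define N where "N = real (card ?V)"
  have N: "N > 0" using n by (simp add: N_def)
  define s where "s = (\<Sum>u\<in>?V. f u)"
  define q where "q = (\<Sum>u\<in>?V. (f u)\<^sup>2)"
  define c where "c = s / N"
  have "s = (\<Sum>u\<in>S. f u * 1)"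
    unfolding s_def using S pair_finite_verts by (simp add: sum.mono_neutral_right)
  then have "s\<^sup>2 \<le> (\<Sum>u\<in>S. (f u)\<^sup>2) * (\<Sum>u\<in>S. 1\<^sup>2)" by (simp only: Cauchy_Schwarz_sum)
  also have "(\<Sum>u\<in>S. (f u)\<^sup>2) = q"
    unfolding q_def using S pair_finite_verts by (intro sum.mono_neutral_left) auto
  also have "q * (\<Sum>u\<in>S. 1\<^sup>2) \<le> q * (N / 2)"
    using S(2) by (intro mult_left_mono) (auto simp: N_def q_def sum_nonneg)
  finally have s2: "s\<^sup>2 / N \<le> q / 2" using N by (simp add: field_simps)
  have "(\<Sum>u\<in>?V. f u - c) = s - N * c" by (simp add: sum_subtractf s_def N_def)
  then have "(\<Sum>u\<in>?V. f u - c) = 0" using N by (simp add: c_def)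
  from algebraic_connectivity_le_Rayleigh[OF n this]
  have "algebraic_connectivity G * (\<Sum>u\<in>?V. (f u - c)\<^sup>2) \<le> dirichlet_energy G f"
    by (simp add: dirichlet_energy_shift)
  moreover have "(\<Sum>u\<in>?V. (f u - c)\<^sup>2) = q - 2 * c * s + N * c\<^sup>2"
    unfolding q_def s_def N_def sum_distrib_left
    by (simp add: power2_diff sum.distrib sum_subtractf mult_ac)
  then have "(\<Sum>u\<in>?V. (f u - c)\<^sup>2) = q - s\<^sup>2 / N"
    using N by (simp add: c_def power2_eq_square field_simps)
  then have "q / 2 \<le> (\<Sum>u\<in>?V. (f u - c)\<^sup>2)" using s2 by simp
  then have "algebraic_connectivity G * (q / 2) \<le> algebraic_connectivity G * (\<Sum>u\<in>?V. (f u - c)\<^sup>2)"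
    using pos by (rule mult_left_mono)
  ultimately show ?thesis by (simp add: q_def)
qed

end

section \<open>Level functions and the energy of radial functions\<close>

locale levelled_graph = pair_graph G for G :: "'a pair_pre_digraph" +
  fixes d :: "'a \<Rightarrow> nat"
  assumes level_arc: "(u, v) \<in> parcs G \<Longrightarrow> d v \<le> Suc (d u)"
begin

definition level_size :: "nat \<Rightarrow> real" where
  "level_size i = real (card {u \<in> pverts G. d u = i})"

definition ball_size :: "nat \<Rightarrow> real" where
  "ball_size i = real (card {u \<in> pverts G. d u \<le> i})"

lemma level_size_nonneg: "0 \<le> level_size i"
  by (simp add: level_size_def)

lemma ball_size_eq_sum: "ball_size i = (\<Sum>j\<le>i. level_size j)"
proof -
  have "{u \<in> pverts G. d u \<le> i} = (\<Union>j\<in>{..i}. {u \<in> pverts G. d u = j})" by auto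
  then have "card {u \<in> pverts G. d u \<le> i} = (\<Sum>j\<le>i. card {u \<in> pverts G. d u = j})"
    by (simp only:) (rule card_UN_disjoint, use pair_finite_verts in auto)
  then show ?thesis by (simp add: ball_size_def level_size_def)
qed

text \<open>Arcs come in both directions, so adjacent vertices lie in equal or consecutive levels.
  Only edges between consecutive levels cost energy, and there are at most as many of them as pairs
  of vertices.\<close>

lemma radial_energy_le:
  fixes g :: "nat \<Rightarrow> real"
  assumes g: "\<And>i. r \<le> i \<Longrightarrow> g i = 0"
  shows "dirichlet_energy G (\<lambda>u. g (d u)) \<le> (\<Sum>i<r. level_size i * level_size (Suc i) * (g i - g (Suc i))\<^sup>2)"
proof -
  let ?V = "pverts G"
  \<comment> \<open>The indicator of the arcs climbing from level \<open>i\<close> to level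
    \<open>Suc i\<close>.\<close>
  define up where "up = (\<lambda>i (u, v). if d u = i \<and> d v = Suc i then 1 else 0 :: real)"
  have bound: "(g (d u) - g (d v))\<^sup>2
      \<le> (\<Sum>i<r. (up i (u, v) + up i (v, u)) * (g i - g (Suc i))\<^sup>2)" if uv: "(u, v) \<in> parcs G" for u v
  proof -
    have nonneg: "0 \<le> (\<Sum>i<r. (up i (u, v) + up i (v, u)) * (g i - g (Suc i))\<^sup>2)"
      by (intro sum_nonneg) (auto simp: up_def)
    have single: "(up i (u, v) + up i (v, u)) * (g i - g (Suc i))\<^sup>2
        \<le> (\<Sum>i<r. (up i (u, v) + up i (v, u)) * (g i - g (Suc i))\<^sup>2)" if "i < r" for i
      using that by (intro member_le_sum[where f = "\<lambda>i. (up i (u, v) + up i (v, u)) * (g i - g (Suc i))\<^sup>2"])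
        (auto simp: up_def)
    consider "d u = d v" | "d v = Suc (d u)" | "d u = Suc (d v)"
      using level_arc[OF uv] level_arc[of v u] uv parcs_commute[of u v] by linarith
    then show ?thesis
    proof cases
      case 1
      then show ?thesis using nonneg by simp
    next
      case 2
      then show ?thesis using nonneg single[of "d u"] g
        by (cases "d u < r") (simp_all add: up_def)
    next
      case 3
      then show ?thesis using nonneg single[of "d v"] g
        by (cases "d v < r") (simp_all add: up_def power2_commute)
    qed
  qed
  have sub: "parcs G \<subseteq> ?V \<times> ?V" using wellformed' by auto
  have up_sum: "(\<Sum>e\<in>?V \<times> ?V. up i e) = level_size i * level_size (Suc i)" for i
  proof -
    have "(\<Sum>e\<in>?V \<times> ?V. up i e) = real (card {e \<in> ?V \<times> ?V. d (fst e) = i \<and> d (snd e) = Suc i})"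
      using pair_finite_verts by (simp add: up_def case_prod_beta flip: sum.inter_filter)
    also have "{e \<in> ?V \<times> ?V. d (fst e) = i \<and> d (snd e) = Suc i}
        = {u \<in> ?V. d u = i} \<times> {u \<in> ?V. d u = Suc i}" by auto
    finally show ?thesis by (simp add: level_size_def card_cartesian_product)
  qed
  \<comment> \<open>A climbing edge is seen through both of its arcs; the resulting factor 2 cancels
    the halving in \<open>dirichlet_energy\<close>.\<close>
  have up_arcs: "(\<Sum>(u, v)\<in>parcs G. up i (u, v) + up i (v, u)) \<le> 2 * (level_size i * level_size (Suc i))" for i
  proof -
    have "(\<Sum>(u, v)\<in>parcs G. up i (v, u)) = (\<Sum>e\<in>parcs G. up i e)"
      by (rule sum.reindex_bij_witness[of _ prod.swap prod.swap])
        (use parcs_commute in \<open>auto\<close>)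
    then have "(\<Sum>(u, v)\<in>parcs G. up i (u, v) + up i (v, u)) = 2 * (\<Sum>e\<in>parcs G. up i e)"
      by (simp add: case_prod_beta sum.distrib)
    also have "(\<Sum>e\<in>parcs G. up i e) \<le> (\<Sum>e\<in>?V \<times> ?V. up i e)"
      using sub pair_finite_verts by (intro sum_mono2) (auto simp: up_def)
    finally show ?thesis by (simp add: up_sum)
  qed
  have "(\<Sum>(u, v)\<in>parcs G. (g (d u) - g (d v))\<^sup>2)
      \<le> (\<Sum>(u, v)\<in>parcs G. \<Sum>i<r. (up i (u, v) + up i (v, u)) * (g i - g (Suc i))\<^sup>2)"
    using bound by (intro sum_mono) auto
  also have "\<dots> = (\<Sum>i<r. (\<Sum>(u, v)\<in>parcs G. up i (u, v) + up i (v, u)) * (g i - g (Suc i))\<^sup>2)"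
    unfolding case_prod_beta sum_distrib_right by (rule sum.swap)
  also have "\<dots> \<le> (\<Sum>i<r. 2 * (level_size i * level_size (Suc i)) * (g i - g (Suc i))\<^sup>2)"
    using up_arcs by (intro sum_mono mult_right_mono) auto
  also have "\<dots> = 2 * (\<Sum>i<r. level_size i * level_size (Suc i) * (g i - g (Suc i))\<^sup>2)"
    by (simp add: sum_distrib_left mult_ac)
  finally show ?thesis by (simp add: dirichlet_energy_def)
qed

section \<open>Growth of a ball that fills at most half of the graph\<close>

context
  fixes r :: nat and v0 :: 'a
  assumes n: "2 \<le> card (pverts G)" and pos: "0 < algebraic_connectivity G"
    and v0: "v0 \<in> pverts G" "d v0 = 0"
    and small: "2 * ball_size r \<le> real (card (pverts G))"
begin

lemma ball_size_ge_1: "1 \<le> ball_size i"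
proof -
  have "{v0} \<subseteq> {u \<in> pverts G. d u \<le> i}" using v0 by auto
  then have "card {v0} \<le> card {u \<in> pverts G. d u \<le> i}"
    using pair_finite_verts by (intro card_mono) auto
  then show ?thesis by (simp add: ball_size_def)
qed

text \<open>Since \<open>g\<close> already vanishes at \<rho>, its support lies in the levels up to
  \<open>r\<close>, that is, in at most half of the vertices. Of the norm only the part on the ball
  of radius \<open>m\<close> is kept.\<close>

lemma radial_Poincare:
  fixes g :: "nat \<Rightarrow> real"
  assumes m: "m \<le> \<rho>" "\<rho> \<le> Suc r" and g: "\<And>i. \<rho> \<le> i \<Longrightarrow> g i = 0" "\<And>i. i \<le> m \<Longrightarrow> g i = g 0"
    and sub: "m \<le> r"
  shows "algebraic_connectivity G * ball_size m * (g 0)\<^sup>2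
      \<le> 2 * (\<Sum>i<\<rho>. level_size i * level_size (Suc i) * (g i - g (Suc i))\<^sup>2)"
proof -
  let ?S = "{u \<in> pverts G. d u \<le> r}"
  have "ball_size m * (g 0)\<^sup>2 = (\<Sum>u\<in>{u \<in> pverts G. d u \<le> m}. (g 0)\<^sup>2)"
    by (simp add: ball_size_def)
  also have "\<dots> = (\<Sum>u\<in>{u \<in> pverts G. d u \<le> m}. (g (d u))\<^sup>2)"
    by (intro sum.cong refl arg_cong[where f = "\<lambda>t. t\<^sup>2"] g(2)[symmetric]) auto
  also have "\<dots> \<le> (\<Sum>u\<in>pverts G. (g (d u))\<^sup>2)"
    using pair_finite_verts by (intro sum_mono2) auto
  finally have "algebraic_connectivity G * (ball_size m * (g 0)\<^sup>2)
      \<le> algebraic_connectivity G * (\<Sum>u\<in>pverts G. (g (d u))\<^sup>2)"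
    using pos by (intro mult_left_mono) auto
  also have "\<dots> \<le> 2 * dirichlet_energy G (\<lambda>u. g (d u))"
    using small m g(1)
    by (intro algebraic_connectivity_le_small_support[OF n less_imp_le[OF pos], of ?S])
      (auto simp: ball_size_def)
  also have "\<dots> \<le> 2 * (\<Sum>i<\<rho>. level_size i * level_size (Suc i) * (g i - g (Suc i))\<^sup>2)"
    using radial_energy_le[of \<rho> g] g(1) by simp
  finally show ?thesis by (simp add: mult.assoc)
qed

text \<open>An isoperimetric inequality, obtained by testing with the indicator of the ball: only
  the edges leaving the ball have energy.\<close>

lemma ball_size_le_cut:
  assumes "i \<le> r"
  shows "algebraic_connectivity G * ball_size i \<le> 2 * (level_size i * level_size (Suc i))"
proof -
  define g where "g j = (if j \<le> i then 1 else 0 :: real)" for j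
  have "(\<Sum>j<Suc i. level_size j * level_size (Suc j) * (g j - g (Suc j))\<^sup>2)
      = level_size i * level_size (Suc i)"
    by (simp add: g_def)
  with radial_Poincare[of i "Suc i" g] assms show ?thesis by (simp add: g_def)
qed

text \<open>Positive connectivity forces edges to leave the ball of radius \<open>i\<close>, so its
  outermost level is inhabited. This keeps the denominators of the next test function
  positive.\<close>

lemma level_size_pos:
  assumes "i \<le> r"
  shows "0 < level_size i"
proof -
  have "0 < algebraic_connectivity G * ball_size i"
    using pos ball_size_ge_1[of i] by (intro mult_pos_pos) auto
  then have "level_size i * level_size (Suc i) > 0" using ball_size_le_cut[OF assms] by linarith
  then show ?thesis using level_size_nonneg[of i] by (cases "level_size i = 0") auto
qed

text \<open>The increments \<open>2 / (s\<^sub>i + s\<^sub>i\<^sub>+\<^sub>1)\<close> make the energy between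
  two consecutive levels of sizes \<open>s\<^sub>i\<close> and \<open>s\<^sub>i\<^sub>+\<^sub>1\<close> at most 1,
  whatever the sizes are.\<close>

lemma ball_growth:
  assumes m: "m < \<rho>" "\<rho> \<le> r"
  shows "algebraic_connectivity G * ball_size m * real (\<rho> - m) ^ 3 \<le> 2 * (ball_size \<rho>)\<^sup>2"
proof -
  let ?\<mu> = "algebraic_connectivity G"
  define L where "L = real (\<rho> - m)"
  have L: "L > 0" using m by (simp add: L_def)
  define t where "t i = level_size i + level_size (Suc i)" for i
  have t: "0 < t i" if "i < \<rho>" for i
    using level_size_pos[of i] level_size_nonneg[of "Suc i"] that m by (simp add: t_def)
  \<comment> \<open>The maximum keeps \<open>g\<close> constant up to \<open>m\<close>; from \<rho>
    on the sum is empty.\<close>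
  define g where "g i = (\<Sum>j\<in>{max i m..<\<rho>}. 2 / t j)" for i
  have diff: "g i - g (Suc i) = (if m \<le> i then 2 / t i else 0)" if "i < \<rho>" for i
    using that sum.atLeast_Suc_lessThan[of i \<rho> "\<lambda>j. 2 / t j"]
    by (auto simp: g_def max_def not_less_eq_eq le_Suc_eq)
  have "(\<Sum>i<\<rho>. level_size i * level_size (Suc i) * (g i - g (Suc i))\<^sup>2) \<le> (\<Sum>i<\<rho>. if m \<le> i then 1 else 0)"
  proof (rule sum_mono)
    fix i assume i: "i \<in> {..<\<rho>}"
    have "4 * (level_size i * level_size (Suc i)) \<le> (t i)\<^sup>2"
      using zero_le_power2[of "level_size i - level_size (Suc i)"]
      by (simp add: t_def power2_eq_square algebra_simps)
    then have "level_size i * level_size (Suc i) * (2 / t i)\<^sup>2 \<le> 1"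
      using t[of i] i by (simp add: power_divide divide_le_eq mult_ac)
    then show "level_size i * level_size (Suc i) * (g i - g (Suc i))\<^sup>2 \<le> (if m \<le> i then 1 else 0)"
      using diff[of i] i by simp
  qed
  also have "\<dots> = L"
  proof -
    have "{i. i < \<rho> \<and> m \<le> i} = {m..<\<rho>}" by auto
    then show ?thesis by (simp add: L_def flip: sum.inter_filter)
  qed
  finally have "2 * (\<Sum>i<\<rho>. level_size i * level_size (Suc i) * (g i - g (Suc i))\<^sup>2) \<le> 2 * L" by simp
  moreover have "?\<mu> * ball_size m * (g 0)\<^sup>2
      \<le> 2 * (\<Sum>i<\<rho>. level_size i * level_size (Suc i) * (g i - g (Suc i))\<^sup>2)"
    using m by (intro radial_Poincare) (auto simp: g_def max_def)
  ultimately have energy: "?\<mu> * ball_size m * (g 0)\<^sup>2 \<le> 2 * L" by linarith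
  \<comment> \<open>Cauchy-Schwarz for the factors \<open>1 / sqrt (t j)\<close> and
    \<open>sqrt (t j)\<close> bounds \<open>g 0\<close> from below: few vertices in the ball force a
    high plateau.\<close>
  have "L\<^sup>2 = (\<Sum>j\<in>{m..<\<rho>}. (1 / sqrt (t j)) * sqrt (t j))\<^sup>2"
  proof -
    have "(\<Sum>j\<in>{m..<\<rho>}. (1 / sqrt (t j)) * sqrt (t j)) = (\<Sum>j\<in>{m..<\<rho>}. 1)"
      using t by (intro sum.cong) (auto simp: less_le)
    then show ?thesis by (simp add: L_def)
  qed
  also have "\<dots> \<le> (\<Sum>j\<in>{m..<\<rho>}. (1 / sqrt (t j))\<^sup>2) * (\<Sum>j\<in>{m..<\<rho>}. (sqrt (t j))\<^sup>2)"
    by (rule Cauchy_Schwarz_sum)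
  also have "(\<Sum>j\<in>{m..<\<rho>}. (1 / sqrt (t j))\<^sup>2) = g 0 / 2"
    using t by (simp add: g_def power_divide less_imp_le sum_divide_distrib)
  also have "(\<Sum>j\<in>{m..<\<rho>}. (sqrt (t j))\<^sup>2) = (\<Sum>j\<in>{m..<\<rho>}. t j)"
    using t by (intro sum.cong) (auto simp: less_imp_le)
  \<comment> \<open>The sum of the \<open>t j\<close> runs through the levels from \<open>m\<close>
    to \<rho> at most twice each.\<close>
  also have "g 0 / 2 * (\<Sum>j\<in>{m..<\<rho>}. t j) \<le> g 0 / 2 * (2 * ball_size \<rho>)"
  proof (rule mult_left_mono)
    have "(\<Sum>j\<in>{m..<\<rho>}. level_size j) \<le> ball_size \<rho>"
      unfolding ball_size_eq_sum by (rule sum_mono2) (auto simp: level_size_nonneg)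
    moreover have "(\<Sum>j\<in>{m..<\<rho>}. level_size (Suc j)) \<le> ball_size \<rho>"
      unfolding sum.shift_bounds_Suc_ivl[symmetric] ball_size_eq_sum
      by (rule sum_mono2) (auto simp: level_size_nonneg)
    ultimately show "(\<Sum>j\<in>{m..<\<rho>}. t j) \<le> 2 * ball_size \<rho>"
      by (simp add: t_def sum.distrib)
    have "0 \<le> g 0" unfolding g_def using t by (intro sum_nonneg) (simp add: less_imp_le)
    then show "0 \<le> g 0 / 2" by simp
  qed
  finally have Lg: "L\<^sup>2 \<le> g 0 * ball_size \<rho>" by simp
  \<comment> \<open>Squaring the lower bound for \<open>g 0\<close> and inserting the energy bound
    leaves a factor \<open>L\<close> on both sides, which is cancelled at the end.\<close>
  have "?\<mu> * ball_size m * L ^ 3 * L = ?\<mu> * ball_size m * (L\<^sup>2)\<^sup>2"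
    by (simp add: power2_eq_square power3_eq_cube)
  also have "\<dots> \<le> ?\<mu> * ball_size m * (g 0 * ball_size \<rho>)\<^sup>2"
    using Lg pos ball_size_ge_1[of m] by (intro mult_left_mono power_mono) auto
  also have "\<dots> = (?\<mu> * ball_size m * (g 0)\<^sup>2) * (ball_size \<rho>)\<^sup>2" by (simp add: power_mult_distrib)
  also have "\<dots> \<le> 2 * L * (ball_size \<rho>)\<^sup>2" using energy by (rule mult_right_mono) simp
  finally show ?thesis using L by (simp flip: L_def)
qed

text \<open>Run contrapositively: for large connectivity, strong induction upwards from radius 1
  shows that the ball of radius \<rho> has more than \<open>n * \<rho>^3 / (2 * r^3)\<close>
  vertices, with \<open>n\<close> the order of the graph. At \<rho> = \<open>r\<close> this exceeds
  half of the graph.\<close>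

lemma algebraic_connectivity_less_of_small_ball:
  assumes r: "1 \<le> r"
  shows "algebraic_connectivity G * real r ^ 3 < 216 * real (card (pverts G))"
proof (rule ccontr)
  let ?\<mu> = "algebraic_connectivity G" and ?n = "real (card (pverts G))"
  assume "\<not> ?thesis"
  then have large: "216 * ?n \<le> ?\<mu> * real r ^ 3" by simp
  have "?n * real \<rho> ^ 3 < 2 * real r ^ 3 * ball_size \<rho>" if "1 \<le> \<rho>" "\<rho> \<le> r" for \<rho>
    using that
  proof (induction \<rho> rule: less_induct)
    case (less \<rho>)
    show ?case
    proof (cases "\<rho> = 1")
      case True
      \<comment> \<open>The cut bound at radius 0, where the ball is level 0 itself, gives half the
        connectivity as a lower bound for level 1.\<close>
      have "level_size 0 * ?\<mu> \<le> level_size 0 * (2 * level_size 1)"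
        using ball_size_le_cut[of 0] by (simp add: ball_size_eq_sum mult_ac)
      then have "?\<mu> \<le> 2 * level_size 1" using level_size_pos[of 0] by simp
      also have "level_size 1 \<le> ball_size 1"
        by (simp add: ball_size_eq_sum level_size_nonneg)
      finally have "real r ^ 3 * ?\<mu> \<le> real r ^ 3 * (2 * ball_size 1)"
        by (intro mult_left_mono) auto
      moreover have "?n < 216 * ?n" using n by simp
      ultimately show ?thesis using large True by (simp add: mult_ac)
    next
      case False
      define m where "m = \<rho> div 2"
      \<comment> \<open>The last two estimates give
        \<open>\<rho>^2 \<le> 6 * m * (\<rho> - m)\<close>; cubing it produces the constant 216. The
        factor 3 is attained at \<rho> = 3.\<close>
      have m: "1 \<le> m" "m < \<rho>" "\<rho> \<le> 3 * m" "\<rho> \<le> 2 * (\<rho> - m)"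
        using False less.prems by (auto simp: m_def)
      have IH: "?n * real m ^ 3 < 2 * real r ^ 3 * ball_size m"
        using less.IH[of m] m less.prems by simp
      show ?thesis
      proof (rule ccontr)
        assume "\<not> ?thesis"
        then have le: "2 * real r ^ 3 * ball_size \<rho> \<le> ?n * real \<rho> ^ 3" by simp
        let ?M = "real m" and ?K = "real (\<rho> - m)" and ?R = "real r ^ 3"
        have MK: "0 < ?M" "0 < ?K" and R: "0 < ?R" using m r by auto
        have "real \<rho> * real \<rho> \<le> (3 * ?M) * (2 * ?K)" using m by (intro mult_mono) linarith+
        then have "(real \<rho> ^ 2) ^ 3 \<le> (6 * (?M * ?K)) ^ 3"
          by (intro power_mono) (auto simp: power2_eq_square)
        then have P6: "(real \<rho> ^ 3)\<^sup>2 \<le> 216 * (?M ^ 3 * ?K ^ 3)"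
          by (simp add: power_mult_distrib flip: power_mult)
        \<comment> \<open>The chain returns to its starting value after one strict step, the
          induction hypothesis at \<open>m\<close>; the other inputs are the assumed connectivity,
          \<open>ball_growth\<close> and the negated claim.\<close>
        have "?n\<^sup>2 * (216 * (?M ^ 3 * ?K ^ 3)) = (?n * ?M ^ 3) * ?K ^ 3 * (216 * ?n)"
          by (simp add: power2_eq_square mult_ac)
        also have "\<dots> \<le> (?n * ?M ^ 3) * ?K ^ 3 * (?\<mu> * ?R)"
          using large by (intro mult_left_mono) auto
        also have "\<dots> < (2 * ?R * ball_size m) * ?K ^ 3 * (?\<mu> * ?R)"
          using IH MK R pos by (intro mult_strict_right_mono) auto
        also have "\<dots> = 2 * ?R\<^sup>2 * (?\<mu> * ball_size m * ?K ^ 3)"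
          by (simp add: power2_eq_square mult_ac)
        also have "\<dots> \<le> 2 * ?R\<^sup>2 * (2 * (ball_size \<rho>)\<^sup>2)"
          using ball_growth[of m \<rho>] m less.prems by (intro mult_left_mono) auto
        also have "\<dots> = (2 * ?R * ball_size \<rho>)\<^sup>2" by (simp add: power_mult_distrib)
        also have "\<dots> \<le> (?n * real \<rho> ^ 3)\<^sup>2"
          using le ball_size_ge_1[of \<rho>] by (intro power_mono) auto
        also have "\<dots> = ?n\<^sup>2 * (real \<rho> ^ 3)\<^sup>2" by (simp add: power_mult_distrib)
        also have "\<dots> \<le> ?n\<^sup>2 * (216 * (?M ^ 3 * ?K ^ 3))" using P6 by (intro mult_left_mono) auto
        finally show False by simp
      qed
    qed
  qed
  from this[of r] small r show False by simp
qed

end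

end

section \<open>Odd closed walks and bipartiteness\<close>

lemma pcas_map_upt: "pcas (f 0) (map (\<lambda>i. (f i, f (Suc i))) [0..<l]) (f l)"
  by (induction l arbitrary: f)
    (simp_all add: upt_conv_Cons comp_def del: upt_Suc flip: map_Suc_upt)

lemma pawalk_verts_map_upt:
  "pawalk_verts (f 0) (map (\<lambda>i. (f i, f (Suc i))) [0..<l]) = map f [0..<Suc l]"
  by (induction l arbitrary: f)
    (simp_all add: upt_conv_Cons comp_def del: upt_Suc flip: map_Suc_upt)

text \<open>A closed odd walk without repetitions is an odd cycle; otherwise a repeated vertex
  splits it into two shorter closed walks, exactly one of them odd.\<close>

lemma (in pair_graph) odd_girth_le_closed_walk:
  assumes "(v, v) \<in> parcs G ^^ l" "odd l"
  shows "odd_girth G \<le> enat l"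
  using assms
proof (induction l arbitrary: v rule: less_induct)
  case (less l)
  obtain f where f: "f 0 = v" "f l = v" "\<And>i. i < l \<Longrightarrow> (f i, f (Suc i)) \<in> parcs G"
    using less.prems(1) by (auto simp: relpow_fun_conv)
  have sub: "(f i, f j) \<in> parcs G ^^ (j - i)" if "i \<le> j" "j \<le> l" for i j
    unfolding relpow_fun_conv by (rule exI[of _ "\<lambda>t. f (i + t)"]) (use that f(3) in auto)
  show ?case
  \<comment> \<open>Index 0 is left out because the walk returns to its start at \<open>l\<close>.
    Hence a repetition has \<open>i \<ge> 1\<close>, and both pieces are strictly shorter.\<close>
  proof (cases "inj_on f {1..l}")
    case True
    define p where "p = map (\<lambda>i. (f i, f (Suc i))) [0..<l]"
    have l: "0 < l" using less.prems(2) by (simp add: odd_pos)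
    have "v \<in> pverts G" using f(1) f(3)[OF l] wellformed' by auto
    then have "awalk v p v"
      unfolding awalk_def using pcas_map_upt[of f l] f by (auto simp: p_def)
    moreover have "distinct (tl (pawalk_verts v p))"
      unfolding p_def f(1)[symmetric] pawalk_verts_map_upt using True
      by (simp add: map_tl[symmetric] distinct_map tl_upt atLeastLessThanSuc_atLeastAtMost del: upt_Suc)
    ultimately have "cycle p" using l unfolding cycle_def by (auto simp: p_def)
    moreover have "length p = l" by (simp add: p_def)
    ultimately show ?thesis
      unfolding odd_girth_def using less.prems(2) by (intro INF_lower2[of p]) auto
  next
    case False
    then obtain i j where ij: "1 \<le> i" "i < j" "j \<le> l" "f i = f j"
      unfolding inj_on_def by (metis atLeastAtMost_iff linorder_neqE_nat)
    show ?thesis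
    proof (cases "odd (j - i)")
      case True
      have "odd_girth G \<le> enat (j - i)"
        using less.IH[of "j - i" "f i"] sub[of i j] ij True by simp
      also have "\<dots> \<le> enat l" using ij by simp
      finally show ?thesis .
    next
      case False
      have "(v, v) \<in> parcs G ^^ i O parcs G ^^ (l - j)"
        using sub[of 0 i] sub[of j l] ij f(1,2) by (auto intro: relcompI)
      then have "(v, v) \<in> parcs G ^^ (i + (l - j))" by (simp add: relpow_add)
      moreover have "odd (i + (l - j))" using False less.prems(2) ij by auto
      ultimately have "odd_girth G \<le> enat (i + (l - j))"
        using less.IH[of "i + (l - j)" v] ij by simp
      also have "\<dots> \<le> enat l" using ij by simp
      finally show ?thesis .
    qed
  qed
qed

text \<open>Distance from \<open>v\<close>, truncated at \<open>K\<close> so that it is total on disconnected graphs.\<close>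

definition walk_level :: "'a pair_pre_digraph \<Rightarrow> nat \<Rightarrow> 'a \<Rightarrow> 'a \<Rightarrow> nat" where
  "walk_level G K v u = (LEAST i. (v, u) \<in> parcs G ^^ i \<or> i = K)"

lemma walk_level_self: "walk_level G K v v = 0"
  unfolding walk_level_def by (rule Least_eq_0) simp

lemma walk_level_le: "walk_level G K v u \<le> K"
  unfolding walk_level_def by (rule Least_le) simp

lemma walk_level_le_walk: "(v, u) \<in> parcs G ^^ i \<Longrightarrow> walk_level G K v u \<le> i"
  unfolding walk_level_def by (rule Least_le) simp

lemma walk_level_walk:
  assumes "walk_level G K v u \<noteq> K"
  shows "(v, u) \<in> parcs G ^^ walk_level G K v u"
proof -
  have "(v, u) \<in> parcs G ^^ walk_level G K v u \<or> walk_level G K v u = K"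
    unfolding walk_level_def by (rule LeastI[of _ K]) simp
  with assms show ?thesis by simp
qed

context pair_graph
begin

lemma walk_level_arc:
  assumes "(u, w) \<in> parcs G"
  shows "walk_level G K v w \<le> Suc (walk_level G K v u)"
proof (cases "walk_level G K v u = K")
  case True
  then show ?thesis using walk_level_le[of G K v w] by simp
next
  case False
  then have "(v, w) \<in> parcs G ^^ Suc (walk_level G K v u)"
    using walk_level_walk[OF False] assms by (auto intro: relcompI)
  then show ?thesis by (rule walk_level_le_walk)
qed

lemma levelled_walk_level: "levelled_graph G (walk_level G K v)"
  by unfold_locales (rule walk_level_arc)

lemma relpow_parcs_sym: "(u, v) \<in> parcs G ^^ i \<Longrightarrow> (v, u) \<in> parcs G ^^ i"
proof (induction i arbitrary: v)
  case (Suc i)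
  then obtain w where "(u, w) \<in> parcs G ^^ i" "(w, v) \<in> parcs G" by auto
  then show ?case using Suc.IH parcs_commute by (blast intro: relpow_Suc_I2)
qed simp

text \<open>Levels below \<open>k\<close> are attained by walks. An arc between levels of equal
  parity joins equal levels \<open>i < k\<close>, and closes a walk of odd length
  \<open>2 * i + 1\<close>, below the odd girth.\<close>

lemma bipartite_if_small_walk_level:
  assumes k: "\<And>u. u \<in> pverts G \<Longrightarrow> walk_level G k v u < k"
    and girth: "enat (2 * k + 1) \<le> odd_girth G"
  shows "bipartite G"
proof -
  let ?d = "walk_level G k v"
  have "even (?d x) \<noteq> even (?d y)" if xy: "(x, y) \<in> parcs G" for x y
  proof
    assume same: "even (?d x) = even (?d y)"
    have "?d x \<le> Suc (?d y)" "?d y \<le> Suc (?d x)"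
      using walk_level_arc xy parcs_commute by blast+
    then have eq: "?d y = ?d x"
      using same by (metis even_Suc le_SucE le_antisym)
    have lt: "?d x < k" "?d y < k" using k xy wellformed' by blast+
    have "(v, x) \<in> parcs G ^^ ?d x" "(v, y) \<in> parcs G ^^ ?d x"
      using walk_level_walk[of G k v x] walk_level_walk[of G k v y] lt eq by auto
    then have "(v, v) \<in> parcs G ^^ (Suc (?d x) + ?d x)"
      using xy relpow_parcs_sym by (subst relpow_add) (auto intro: relcompI)
    then have "odd_girth G \<le> enat (Suc (?d x) + ?d x)"
      by (rule odd_girth_le_closed_walk) simp
    with girth have "enat (2 * k + 1) \<le> enat (Suc (?d x) + ?d x)" by (rule order_trans)
    then show False using lt by simp
  qed
  then show ?thesis
    unfolding bipartite_def using wellformed'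
    by (intro exI[of _ "{u \<in> pverts G. even (?d u)}"] exI[of _ "{u \<in> pverts G. odd (?d u)}"]) blast
qed

section \<open>Large algebraic connectivity forces bipartiteness\<close>

lemma bipartite_if_large_algebraic_connectivity:
  assumes k: "22 \<le> k" and n: "2 \<le> card (pverts G)"
    and girth: "enat (2 * k + 1) \<le> odd_girth G"
    and large: "3456 * real (card (pverts G)) / real k ^ 3 < algebraic_connectivity G"
  shows "bipartite G"
proof (rule ccontr)
  assume nonbip: "\<not> bipartite G"
  let ?\<mu> = "algebraic_connectivity G" and ?n = "real (card (pverts G))"
  obtain v where v: "v \<in> pverts G" using n by fastforce
  obtain w where w: "w \<in> pverts G" "\<not> walk_level G k v w < k"
    using bipartite_if_small_walk_level[of k v] girth nonbip by blast
  \<comment> \<open>The largest radius with \<open>2 * r < k\<close>, so that a common vertex of the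
    balls around \<open>v\<close> and \<open>w\<close> would give a walk of length below
    \<open>k\<close> between the centres.\<close>
  define r where "r = (k - 1) div 2"
  have r: "10 \<le> r" "2 * r < k" "k \<le> 2 * r + 2" using k by (auto simp: r_def)
  \<comment> \<open>Truncating at \<open>Suc r\<close> ensures that levels up to \<open>r\<close>
    come from walks.\<close>
  define S where "S x = {u \<in> pverts G. walk_level G (Suc r) x u \<le> r}" for x
  have walk: "\<exists>i\<le>r. (x, u) \<in> parcs G ^^ i" if "u \<in> S x" for x u
    using that walk_level_walk[of G "Suc r" x u] by (auto simp: S_def)
  have "S v \<inter> S w = {}"
  proof (rule ccontr)
    assume "S v \<inter> S w \<noteq> {}"
    then obtain u i j where "i \<le> r" "(v, u) \<in> parcs G ^^ i" "j \<le> r" "(w, u) \<in> parcs G ^^ j"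
      using walk by blast
    moreover from this have "(v, w) \<in> parcs G ^^ (i + j)"
      using relpow_parcs_sym by (subst relpow_add) (auto intro: relcompI)
    ultimately have "walk_level G k v w < k"
      using walk_level_le_walk[of v w "i + j" G k] r(2) by linarith
    with w show False by simp
  qed
  then have "card (S v) + card (S w) = card (S v \<union> S w)"
    by (intro card_Un_disjoint[symmetric]) (auto simp: S_def pair_finite_verts)
  also have "\<dots> \<le> card (pverts G)"
    by (intro card_mono pair_finite_verts) (auto simp: S_def)
  finally have "2 * card (S v) \<le> card (pverts G) \<or> 2 * card (S w) \<le> card (pverts G)" by linarith
  then obtain x where x: "x \<in> pverts G" "2 * card (S x) \<le> card (pverts G)"
    using v w by blast
  interpret levelled_graph G "walk_level G (Suc r) x" by (rule levelled_walk_level)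
  have "0 \<le> 3456 * ?n / real k ^ 3" by simp
  then have pos: "0 < ?\<mu>" using large by linarith
  have "2 * ball_size r \<le> ?n" using x(2) by (simp add: ball_size_def S_def)
  then have upper: "?\<mu> * real r ^ 3 < 216 * ?n"
    using r by (intro algebraic_connectivity_less_of_small_ball[OF n pos x(1) walk_level_self]) auto
  \<comment> \<open>From \<open>k \<le> 2 * r + 2\<close> and \<open>r \<ge> 10\<close>, the latter
    being where \<open>k \<ge> 22\<close> enters. The cube of 11/5 is below 16, and 3456 = 16 *
    216.\<close>
  have "real k \<le> 11 / 5 * real r" using r by linarith
  then have "real k ^ 3 \<le> (11 / 5 * real r) ^ 3" by (intro power_mono) auto
  also have "\<dots> \<le> 16 * real r ^ 3" by (simp add: power_mult_distrib power3_eq_cube)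
  finally have "?\<mu> * real k ^ 3 \<le> ?\<mu> * (16 * real r ^ 3)" using pos by (intro mult_left_mono) auto
  moreover have "3456 * ?n < ?\<mu> * real k ^ 3"
    using large k by (simp add: divide_less_eq mult_ac)
  ultimately show False using upper by linarith
qed

end

section \<open>Odd cycles\<close>

definition cycle_graph :: "nat \<Rightarrow> nat pair_pre_digraph" where
  "cycle_graph n = \<lparr> pverts = {..<n},
     parcs = {(i, j). i < n \<and> j < n \<and> (j = Suc i mod n \<or> i = Suc j mod n)} \<rparr>"

lemma cycle_graph_simps [simp]:
  "pverts (cycle_graph n) = {..<n}"
  "(i, j) \<in> parcs (cycle_graph n) \<longleftrightarrow> i < n \<and> j < n \<and> (j = Suc i mod n \<or> i = Suc j mod n)"
  by (auto simp: cycle_graph_def)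

lemma pair_graph_cycle_graph:
  assumes "2 \<le> n"
  shows "pair_graph (cycle_graph n)"
proof
  show "finite (parcs (cycle_graph n))"
    by (rule finite_subset[of _ "{..<n} \<times> {..<n}"]) (auto simp: cycle_graph_def)
  show "fst e \<noteq> snd e" if "e \<in> parcs (cycle_graph n)" for e
    using that assms by (cases e) (auto simp: mod_Suc split: if_splits)
  show "symmetric (with_proj (cycle_graph n))"
    by (auto simp: symmetric_def intro!: symI)
qed (auto simp: cycle_graph_def)

text \<open>The integer \<open>z\<close> is the displacement of the walk lifted to the integer line:
  steps forward minus steps backward.\<close>

lemma cycle_graph_walk_displacement:
  assumes "pcas u p v" "set p \<subseteq> parcs (cycle_graph n)"
  shows "\<exists>z::int. \<bar>z\<bar> \<le> int (length p) \<and> (even z \<longleftrightarrow> even (length p)) \<and> int n dvd int v - int u - z"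
  using assms
proof (induction p arbitrary: u)
  case Nil
  then show ?case by (intro exI[of _ 0]) simp
next
  case (Cons e p)
  obtain w where e: "e = (u, w)" using Cons.prems(1) by (cases e) auto
  obtain z where z: "\<bar>z\<bar> \<le> int (length p)" "even z \<longleftrightarrow> even (length p)" "int n dvd int v - int w - z"
    using Cons.IH[of w] Cons.prems e by auto
  have step: "int n dvd int (Suc i mod n) - int i - 1" for i
  proof -
    have "int (Suc i mod n) mod int n = (int i + 1) mod int n"
      by (simp add: zmod_int add.commute)
    then have "int n dvd int (Suc i mod n) - (int i + 1)" by (simp add: mod_eq_dvd_iff)
    then show ?thesis by (simp add: algebra_simps)
  qed
  have "\<exists>y::int. \<bar>y\<bar> = 1 \<and> int n dvd int w - int u - y"
  proof (cases "w = Suc u mod n")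
    case True
    then show ?thesis using step[of u] by (intro exI[of _ 1]) simp
  next
    case False
    then have "u = Suc w mod n" using Cons.prems e by auto
    then have "int n dvd - (int w - int u - (-1))" using step[of w] by (simp add: algebra_simps)
    then show ?thesis unfolding dvd_minus_iff by (intro exI[of _ "-1"]) simp
  qed
  then obtain y :: int where y: "\<bar>y\<bar> = 1" "int n dvd int w - int u - y" by blast
  have "int n dvd int v - int u - (z + y)"
    using dvd_add[OF z(3) y(2)] by (simp add: algebra_simps)
  moreover have "\<bar>z + y\<bar> \<le> int (length (e # p))" using z(1) y(1) by simp
  moreover have "even (z + y) \<longleftrightarrow> even (length (e # p))" using z(2) y(1) by (auto simp: abs_if split: if_splits)
  ultimately show ?case by blast
qed

text \<open>A closed walk of odd length has an odd, hence nonzero, displacement divisible by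
  \<open>n\<close>, so it has at least \<open>n\<close> steps.\<close>

lemma odd_girth_cycle_graph: "enat n \<le> odd_girth (cycle_graph n)"
  unfolding odd_girth_def
proof (rule INF_greatest)
  fix p assume "p \<in> {p. pre_digraph.cycle (with_proj (cycle_graph n)) p \<and> odd (length p)}"
  then obtain u where p: "pcas u p u" "set p \<subseteq> parcs (cycle_graph n)" "odd (length p)"
    by (auto simp: pre_digraph.cycle_def pre_digraph.awalk_def cas_with_proj_eq)
  obtain z :: int where z: "\<bar>z\<bar> \<le> int (length p)" "odd z" "int n dvd - z"
    using cycle_graph_walk_displacement[OF p(1,2)] p(3) by auto
  then have "int n \<le> \<bar>z\<bar>" using dvd_imp_le_int[of z "int n"] by auto
  with z show "enat n \<le> enat (length p)" by simp
qed

text \<open>Sides alternate along the path from 0 to \<open>n - 1\<close>, whose ends thus share a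
  side although they are adjacent.\<close>

lemma not_bipartite_cycle_graph:
  assumes "odd n" "3 \<le> n"
  shows "\<not> bipartite (cycle_graph n)"
proof
  assume "bipartite (cycle_graph n)"
  then obtain A B where AB: "A \<inter> B = {}"
    "\<forall>(u, v)\<in>parcs (cycle_graph n). u \<in> A \<and> v \<in> B \<or> u \<in> B \<and> v \<in> A"
    unfolding bipartite_def by (elim exE conjE) (rule that)
  have alt: "v \<in> A \<longleftrightarrow> u \<notin> A" if "(u, v) \<in> parcs (cycle_graph n)" for u v
    using AB(1) bspec[OF AB(2) that] by auto
  have parity: "i \<in> A \<longleftrightarrow> (even i \<longleftrightarrow> 0 \<in> A)" if "i < n" for i
    using that
  proof (induction i)
    case (Suc i)
    then have "(i, Suc i) \<in> parcs (cycle_graph n)" by simp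
    from alt[OF this] show ?case using Suc.IH Suc.prems by auto
  qed simp
  have "n - 1 \<in> A \<longleftrightarrow> 0 \<in> A" using parity[of "n - 1"] assms by simp
  moreover have "(n - 1, 0) \<in> parcs (cycle_graph n)" using assms by simp
  ultimately show False using alt by blast
qed

text \<open>Two vertices are joined by a path of fewer than \<open>n\<close> edges, so
  Cauchy-Schwarz bounds their squared difference by \<open>n\<close> times the energy. Summing over
  all pairs gives the norm, because \<open>f\<close> has mean zero.\<close>

lemma cycle_graph_Poincare:
  assumes n: "3 \<le> n" and f: "(\<Sum>i<n. f i) = 0"
  shows "2 / (real n)\<^sup>2 * (\<Sum>i<n. (f i)\<^sup>2) \<le> dirichlet_energy (cycle_graph n) f"
proof -
  interpret pair_graph "cycle_graph n" using n by (intro pair_graph_cycle_graph) simp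
  let ?D = "dirichlet_energy (cycle_graph n) f"
  define \<Delta> where "\<Delta> t = (f (Suc t) - f t)\<^sup>2" for t
  \<comment> \<open>Both orientations of the path edges; the closing edge of the cycle only adds to
    the energy.\<close>
  let ?P = "(\<lambda>t. (t, Suc t)) ` {..<n-1}" and ?Q = "(\<lambda>t. (Suc t, t)) ` {..<n-1}"
  have "(\<Sum>t<n-1. \<Delta> t) + (\<Sum>t<n-1. \<Delta> t)
      = (\<Sum>(u, v)\<in>?P. (f u - f v)\<^sup>2) + (\<Sum>(u, v)\<in>?Q. (f u - f v)\<^sup>2)"
    by (simp add: sum.reindex inj_on_def \<Delta>_def power2_commute)
  also have "\<dots> = (\<Sum>(u, v)\<in>?P \<union> ?Q. (f u - f v)\<^sup>2)"
    by (rule sum.union_disjoint[symmetric]) auto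
  also have "\<dots> \<le> (\<Sum>(u, v)\<in>parcs (cycle_graph n). (f u - f v)\<^sup>2)"
    using pair_finite_arcs by (intro sum_mono2) auto
  finally have path: "(\<Sum>t<n-1. \<Delta> t) \<le> ?D" by (simp add: dirichlet_energy_def)
  have le: "(f i - f j)\<^sup>2 \<le> real n * ?D" if "i \<le> j" "j < n" for i j
  proof -
    have "(f i - f j)\<^sup>2 = (f j - f i)\<^sup>2" by (rule power2_commute)
    also have "f j - f i = (\<Sum>t\<in>{i..<j}. (f (Suc t) - f t) * 1)"
      using that(1) by (simp add: sum_Suc_diff')
    also have "(\<Sum>t\<in>{i..<j}. (f (Suc t) - f t) * 1)\<^sup>2
        \<le> (\<Sum>t\<in>{i..<j}. \<Delta> t) * (\<Sum>t\<in>{i..<j}. 1\<^sup>2)"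
      unfolding \<Delta>_def by (rule Cauchy_Schwarz_sum)
    also have "\<dots> \<le> (\<Sum>t<n-1. \<Delta> t) * real n"
      using that by (intro mult_mono sum_mono2 sum_nonneg) (auto simp: \<Delta>_def)
    also have "\<dots> \<le> real n * ?D" using path by (simp add: mult.commute mult_left_mono)
    finally show ?thesis .
  qed
  have "(\<Sum>i<n. \<Sum>j<n. (f i - f j)\<^sup>2) \<le> (\<Sum>i<n. \<Sum>j<n. real n * ?D)"
  proof (intro sum_mono)
    fix i j assume "i \<in> {..<n}" "j \<in> {..<n}"
    then show "(f i - f j)\<^sup>2 \<le> real n * ?D"
      using le[of i j] le[of j i] by (cases "i \<le> j") (auto simp: power2_commute)
  qed
  moreover have "(\<Sum>i<n. \<Sum>j<n. (f i - f j)\<^sup>2) = 2 * real n * (\<Sum>i<n. (f i)\<^sup>2)"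
  proof -
    have "(\<Sum>i<n. \<Sum>j<n. (f i - f j)\<^sup>2)
        = (\<Sum>i<n. \<Sum>j<n. (f i)\<^sup>2) + (\<Sum>i<n. \<Sum>j<n. (f j)\<^sup>2) - 2 * (\<Sum>i<n. \<Sum>j<n. f i * f j)"
      unfolding sum.distrib[symmetric] sum_subtractf[symmetric] sum_distrib_left
      by (intro sum.cong refl) (simp add: power2_diff)
    then show ?thesis using f by (simp add: sum_product[symmetric] flip: sum_distrib_left)
  qed
  ultimately have "real n * (2 * (\<Sum>i<n. (f i)\<^sup>2)) \<le> real n * ((real n)\<^sup>2 * ?D)"
    by (simp add: power2_eq_square mult_ac)
  then have "2 * (\<Sum>i<n. (f i)\<^sup>2) \<le> (real n)\<^sup>2 * ?D" using n by simp
  then show ?thesis using n by (simp add: divide_le_eq mult_ac)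
qed

lemma algebraic_connectivity_cycle_graph:
  assumes "3 \<le> n"
  shows "2 / (real n)\<^sup>2 \<le> algebraic_connectivity (cycle_graph n)"
proof -
  interpret pair_graph "cycle_graph n" using assms by (intro pair_graph_cycle_graph) simp
  show ?thesis
    using assms cycle_graph_Poincare by (intro algebraic_connectivity_geI) auto
qed

theorem theorem1p5:
  shows "(\<forall>k::nat. k \<ge> 22 \<longrightarrow>
      (\<forall>G :: 'a pair_pre_digraph.
         pair_graph G \<and> card (pverts G) \<ge> 2 \<and>
         odd_girth G \<ge> enat (2 * k + 1) \<and>
         algebraic_connectivity G > 3456 * real (card (pverts G)) / real k ^ 3
         \<longrightarrow> bipartite G))
    \<and> (\<exists>c::real. c > 0 \<and> (\<exists>k0::nat. \<forall>k::nat. k \<ge> k0 \<longrightarrow>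
      (\<exists>G :: nat pair_pre_digraph.
         pair_graph G \<and> card (pverts G) \<ge> 2 \<and>
         \<not> bipartite G \<and>
         odd_girth G \<ge> enat (2 * k + 1) \<and>
         algebraic_connectivity G \<ge> c * real (card (pverts G)) / real k ^ 3)))"
proof (intro conjI)
  show "\<forall>k::nat. k \<ge> 22 \<longrightarrow>
      (\<forall>G :: 'a pair_pre_digraph.
         pair_graph G \<and> card (pverts G) \<ge> 2 \<and>
         odd_girth G \<ge> enat (2 * k + 1) \<and>
         algebraic_connectivity G > 3456 * real (card (pverts G)) / real k ^ 3
         \<longrightarrow> bipartite G)"
    by (intro allI impI, elim conjE, rule pair_graph.bipartite_if_large_algebraic_connectivity)
next
  have cycle: "pair_graph (cycle_graph (2 * k + 1)) \<and> card (pverts (cycle_graph (2 * k + 1))) \<ge> 2 \<and>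
      \<not> bipartite (cycle_graph (2 * k + 1)) \<and>
      odd_girth (cycle_graph (2 * k + 1)) \<ge> enat (2 * k + 1) \<and>
      algebraic_connectivity (cycle_graph (2 * k + 1))
        \<ge> 2 / 27 * real (card (pverts (cycle_graph (2 * k + 1)))) / real k ^ 3" if k: "k \<ge> 1" for k
  proof -
    let ?n = "2 * k + 1"
    \<comment> \<open>Writing \<open>2 / n^2\<close> as \<open>2 * n / n^3\<close> and using
      \<open>2 * k + 1 \<le> 3 * k\<close> for \<open>k \<ge> 1\<close> gives the constant
      2/27.\<close>
    have "real ?n ^ 3 \<le> (3 * real k) ^ 3" using k by (intro power_mono) auto
    then have "real ?n ^ 3 \<le> 27 * real k ^ 3" by (simp only: power_mult_distrib) simp
    moreover have "2 / 27 * real ?n * (real ?n)\<^sup>2 = 2 / 27 * real ?n ^ 3"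
      by (simp only: power2_eq_square power3_eq_cube mult.assoc)
    ultimately have "2 / 27 * real ?n * (real ?n)\<^sup>2 \<le> 2 * real k ^ 3" by linarith
    then have "2 / 27 * real ?n / real k ^ 3 \<le> 2 / (real ?n)\<^sup>2"
      using k by (simp add: divide_simps mult_ac)
    also have "\<dots> \<le> algebraic_connectivity (cycle_graph ?n)"
      using k by (intro algebraic_connectivity_cycle_graph) simp
    finally show ?thesis
      using k pair_graph_cycle_graph[of ?n] not_bipartite_cycle_graph[of ?n] odd_girth_cycle_graph[of ?n]
      by simp
  qed
  show "\<exists>c::real. c > 0 \<and> (\<exists>k0::nat. \<forall>k::nat. k \<ge> k0 \<longrightarrow>
      (\<exists>G :: nat pair_pre_digraph.
         pair_graph G \<and> card (pverts G) \<ge> 2 \<and>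
         \<not> bipartite G \<and>
         odd_girth G \<ge> enat (2 * k + 1) \<and>
         algebraic_connectivity G \<ge> c * real (card (pverts G)) / real k ^ 3))"
  proof (intro exI[of _ "2 / 27 :: real"] conjI exI[of _ "1 :: nat"] allI impI)
    fix k :: nat assume "1 \<le> k"
    from cycle[OF this] show "\<exists>G :: nat pair_pre_digraph.
         pair_graph G \<and> card (pverts G) \<ge> 2 \<and>
         \<not> bipartite G \<and>
         odd_girth G \<ge> enat (2 * k + 1) \<and>
         algebraic_connectivity G \<ge> 2 / 27 * real (card (pverts G)) / real k ^ 3"
      by (rule exI)
  qed simp
qed

end
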